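(* There exists a countable, finitely branching and acyclic MDP $\mathcal{M}$ with integer transition rewards and initial state $s_0$, whose total reward is implicit in the state, such that (1) there exists a history-dependent deterministic (HD) strategy $\sigma$ with $\mathcal{P}_{\mathcal{M},s_0,\sigma}(\mathit{MP}_{\liminf\ge 0})=1$, and (2) every finite-memory randomized (FR) strategy $\sigma$ satisfies $\mathcal{P}_{\mathcal{M},s_0,\sigma}(\mathit{MP}_{\liminf\ge 0})=0$, where $\mathit{MP}_{\liminf\ge 0}=\{\rho\mid \liminf_{n\to\infty}\frac1n\sum_{j=0}^{n-1} r(e_j)\ge 0\}$.
   Context: An MDP has a countable set of states partitioned into controlled and random states, a transition relation (every state has a successor), fixed probability distributions over successors at random states, and real rewards on transitions; runs are $s_0e_0s_1e_1\dots$ with transitions $e_j$. It is finitely branching if each state has finitely many successors and acyclic if its transition graph has no directed cycle. The total reward is implicit in the state if for every state $s$ all finite paths from $s_0$ to $s$ have the same sum of transition rewards. A strategy assigns to each finite partial run ending in a controlled state a distribution over successors, inducing a probability measure $\mathcal{P}_{\mathcal{M},s_0,\sigma}$ on runs. HD strategies are arbitrary history-dependent strategies whose choices are Dirac distributions. FR strategies are those implementable with a finite set of memory modes and (possibly randomized) memory updates and choices depending on the current mode and state. *)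

theory Defs
  imports "HOL-Probability.Probability"
begin

text \<open>The random states are \<open>states M - controlled M\<close>.
  The values of \<open>prob M\<close> off the random states and of \<open>rew M\<close> off the transitions are irrelevant.\<close>

record 'a mdp =
  states :: "'a set"
  controlled :: "'a set"
  transitions :: "('a \<times> 'a) set"
  prob :: "'a \<Rightarrow> 'a pmf"
  rew :: "'a \<times> 'a \<Rightarrow> real"

abbreviation successors :: "('a, 'z) mdp_scheme \<Rightarrow> 'a \<Rightarrow> 'a set" where
  "successors M s \<equiv> transitions M `` {s}"

definition is_mdp :: "('a, 'z) mdp_scheme \<Rightarrow> bool" where
  "is_mdp M \<longleftrightarrow>
     countable (states M) \<and> controlled M \<subseteq> states M \<and> transitions M \<subseteq> states M \<times> states M \<and>
     (\<forall>s\<in>states M. successors M s \<noteq> {}) \<and>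
     (\<forall>s\<in>states M - controlled M. set_pmf (prob M s) \<subseteq> successors M s)"

definition finitely_branching :: "('a, 'z) mdp_scheme \<Rightarrow> bool" where
  "finitely_branching M \<longleftrightarrow> (\<forall>s\<in>states M. finite (successors M s))"

text \<open>A transition \<open>e = (s, t)\<close> is determined by its end points, so (partial) runs are represented by
  their sequences of states.\<close>

definition partial_run :: "('a, 'z) mdp_scheme \<Rightarrow> 'a list \<Rightarrow> bool" where
  "partial_run M w \<longleftrightarrow>
     w \<noteq> [] \<and> set w \<subseteq> states M \<and> successively (\<lambda>s t. (s, t) \<in> transitions M) w"

definition runs :: "('a, 'z) mdp_scheme \<Rightarrow> 'a \<Rightarrow> (nat \<Rightarrow> 'a) set" where
  "runs M s\<^sub>0 = {\<rho>. \<rho> 0 = s\<^sub>0 \<and> (\<forall>i. (\<rho> i, \<rho> (Suc i)) \<in> transitions M)}"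

definition path_reward :: "('a, 'z) mdp_scheme \<Rightarrow> 'a list \<Rightarrow> real" where
  "path_reward M w = (\<Sum>i<length w - 1. rew M (w ! i, w ! Suc i))"

definition reward_implicit :: "('a, 'z) mdp_scheme \<Rightarrow> 'a \<Rightarrow> bool" where
  "reward_implicit M s\<^sub>0 \<longleftrightarrow>
     (\<forall>v w. partial_run M v \<and> partial_run M w \<and> hd v = s\<^sub>0 \<and> hd w = s\<^sub>0 \<and> last v = last w \<longrightarrow>
        path_reward M v = path_reward M w)"

definition strategy :: "('a, 'z) mdp_scheme \<Rightarrow> ('a list \<Rightarrow> 'a pmf) \<Rightarrow> bool" where
  "strategy M \<sigma> \<longleftrightarrow>
     (\<forall>w. partial_run M w \<and> last w \<in> controlled M \<longrightarrow> set_pmf (\<sigma> w) \<subseteq> successors M (last w))"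

definition HD_strategy :: "('a, 'z) mdp_scheme \<Rightarrow> ('a list \<Rightarrow> 'a pmf) \<Rightarrow> bool" where
  "HD_strategy M \<sigma> \<longleftrightarrow> strategy M \<sigma> \<and>
     (\<forall>w. partial_run M w \<and> last w \<in> controlled M \<longrightarrow> (\<exists>t. \<sigma> w = return_pmf t))"

text \<open>A memory structure with set of modes \<open>Q\<close>: in mode \<open>m\<close> and state \<open>s\<close>, the distribution \<open>\<tau> m s\<close>
  jointly chooses the next mode and the next state. At random states only the next mode
  (possibly depending on the successor) is under control.\<close>

definition memory_structure ::
    "('a, 'z) mdp_scheme \<Rightarrow> 'm set \<Rightarrow> ('m \<Rightarrow> 'a \<Rightarrow> ('m \<times> 'a) pmf) \<Rightarrow> bool" where
  "memory_structure M Q \<tau> \<longleftrightarrow>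
     (\<forall>m\<in>Q. \<forall>s\<in>states M. set_pmf (\<tau> m s) \<subseteq> Q \<times> successors M s) \<and>
     (\<forall>m\<in>Q. \<forall>s\<in>states M - controlled M. map_pmf snd (\<tau> m s) = prob M s)"

text \<open>The law of the first \<open>n + 1\<close> (mode, state) pairs of the Markov chain with transition
  probabilities \<open>\<tau>\<close> started in mode \<open>m\<^sub>0\<close> and state \<open>s\<close>.\<close>

primrec memory_chain ::
    "('m \<Rightarrow> 'a \<Rightarrow> ('m \<times> 'a) pmf) \<Rightarrow> 'm \<Rightarrow> 'a \<Rightarrow> nat \<Rightarrow> ('m \<times> 'a) list pmf" where
  "memory_chain \<tau> m\<^sub>0 s 0 = return_pmf [(m\<^sub>0, s)]"
| "memory_chain \<tau> m\<^sub>0 s (Suc n) =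
     bind_pmf (memory_chain \<tau> m\<^sub>0 s n)
       (\<lambda>h. map_pmf (\<lambda>x. h @ [x]) (case last h of (m, t) \<Rightarrow> \<tau> m t))"

text \<open>The strategy induced by \<open>\<tau>\<close> and the initial mode \<open>m\<^sub>0\<close>: after the partial run \<open>w\<close>, the current mode
  is distributed as in the Markov chain conditioned on having visited exactly the states \<open>w\<close>, and the
  next state is chosen by \<open>\<tau>\<close> from that mode. It is only meaningful if \<open>w\<close> has positive
  probability in the chain.\<close>

definition memory_compatible ::
    "('m \<Rightarrow> 'a \<Rightarrow> ('m \<times> 'a) pmf) \<Rightarrow> 'm \<Rightarrow> 'a list \<Rightarrow> bool" where
  "memory_compatible \<tau> m\<^sub>0 w \<longleftrightarrow>
     set_pmf (memory_chain \<tau> m\<^sub>0 (hd w) (length w - 1)) \<inter> {h. map snd h = w} \<noteq> {}"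

definition induced_strategy ::
    "('m \<Rightarrow> 'a \<Rightarrow> ('m \<times> 'a) pmf) \<Rightarrow> 'm \<Rightarrow> 'a list \<Rightarrow> 'a pmf" where
  "induced_strategy \<tau> m\<^sub>0 w =
     bind_pmf (cond_pmf (memory_chain \<tau> m\<^sub>0 (hd w) (length w - 1)) {h. map snd h = w})
       (\<lambda>h. map_pmf snd (\<tau> (fst (last h)) (last w)))"

text \<open>Any finite set of modes can be renamed to a set of natural numbers. On partial runs of
  probability 0 in the chain, which are also of probability 0 under \<open>\<sigma>\<close>, there is no constraint.\<close>

definition FR_strategy :: "('a, 'z) mdp_scheme \<Rightarrow> ('a list \<Rightarrow> 'a pmf) \<Rightarrow> bool" where
  "FR_strategy M \<sigma> \<longleftrightarrow> strategy M \<sigma> \<and>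
     (\<exists>(Q :: nat set) \<tau> m\<^sub>0. finite Q \<and> m\<^sub>0 \<in> Q \<and> memory_structure M Q \<tau> \<and>
        (\<forall>w. partial_run M w \<and> last w \<in> controlled M \<and> memory_compatible \<tau> m\<^sub>0 w \<longrightarrow>
           \<sigma> w = induced_strategy \<tau> m\<^sub>0 w))"

definition next_state ::
    "('a, 'z) mdp_scheme \<Rightarrow> ('a list \<Rightarrow> 'a pmf) \<Rightarrow> 'a list \<Rightarrow> 'a pmf" where
  "next_state M \<sigma> w = (if last w \<in> controlled M then \<sigma> w else prob M (last w))"

definition run_kernel ::
    "('a, 'z) mdp_scheme \<Rightarrow> 'a \<Rightarrow> ('a list \<Rightarrow> 'a pmf) \<Rightarrow> nat \<Rightarrow> (nat \<Rightarrow> 'a) \<Rightarrow> 'a measure" where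
  "run_kernel M s\<^sub>0 \<sigma> i \<rho> =
     measure_pmf (if i = 0 then return_pmf s\<^sub>0 else next_state M \<sigma> (map \<rho> [0..<i]))"

text \<open>The measure on state sequences given by the theorem of Ionescu Tulcea. It is characterised by
  its values on cylinders, see \<open>emeasure_run_measure_cylinder\<close> below.\<close>

definition run_measure ::
    "('a::countable, 'z) mdp_scheme \<Rightarrow> 'a \<Rightarrow> ('a list \<Rightarrow> 'a pmf) \<Rightarrow> (nat \<Rightarrow> 'a) measure" where
  "run_measure M s\<^sub>0 \<sigma> =
     projective_family.lim UNIV
       (Ionescu_Tulcea.CI (run_kernel M s\<^sub>0 \<sigma>) (\<lambda>_. count_space UNIV)) (\<lambda>_. count_space UNIV)"

definition MP_liminf_nonneg :: "('a, 'z) mdp_scheme \<Rightarrow> 'a \<Rightarrow> (nat \<Rightarrow> 'a) set" where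
  "MP_liminf_nonneg M s\<^sub>0 =
     {\<rho> \<in> runs M s\<^sub>0.
        liminf (\<lambda>n. ereal (1 / real n * (\<Sum>j<n. rew M (\<rho> j, \<rho> (Suc j))))) \<ge> 0}"

lemma sets_PiM_countable_discrete:
  assumes "finite I"
  shows "sets (PiM I (\<lambda>_. count_space (UNIV :: 'a::countable set))) = Pow (PiE I (\<lambda>_. UNIV))"
proof -
  have "countable (PiE I (\<lambda>_. UNIV :: 'a set))"
    using assms by (intro countable_PiE) auto
  moreover have "{x} \<in> sets (PiM I (\<lambda>_. count_space (UNIV :: 'a set)))"
    if "x \<in> PiE I (\<lambda>_. UNIV)" for x
  proof -
    have "{x} = PiE I (\<lambda>i. {x i})"
      using that by (simp add: PiE_singleton PiE_iff)
    also have "\<dots> \<in> sets (PiM I (\<lambda>_. count_space UNIV))"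
      using assms by (intro sets_PiM_I_finite) auto
    finally show ?thesis .
  qed
  ultimately have "A \<in> sets (PiM I (\<lambda>_. count_space (UNIV :: 'a set)))"
    if "A \<subseteq> PiE I (\<lambda>_. UNIV)" for A
    using that by (intro sets.countable[of A]) (auto intro: countable_subset)
  then show ?thesis
    using sets.sets_into_space[of _ "PiM I (\<lambda>_. count_space (UNIV :: 'a set))"]
    by (auto simp: space_PiM)
qed

lemma Ionescu_Tulcea_run_kernel:
  fixes M :: "('a::countable, 'z) mdp_scheme"
  shows "Ionescu_Tulcea (run_kernel M s\<^sub>0 \<sigma>) (\<lambda>_. count_space UNIV)"
proof (rule Ionescu_Tulcea.intro)
  let ?M = "\<lambda>_::nat. count_space (UNIV :: 'a set)"
  show "run_kernel M s\<^sub>0 \<sigma> i \<in> PiM {0..<i} ?M \<rightarrow>\<^sub>M subprob_algebra (count_space UNIV)" for i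
  proof -
    have "PiM {0..<i} ?M \<rightarrow>\<^sub>M subprob_algebra (count_space (UNIV :: 'a set)) =
        count_space (PiE {0..<i} (\<lambda>_. UNIV)) \<rightarrow>\<^sub>M subprob_algebra (count_space UNIV)"
      by (rule measurable_cong_sets) (simp_all add: sets_PiM_countable_discrete)
    then show ?thesis
      by (auto simp: run_kernel_def measure_pmf_in_subprob_algebra)
  qed
qed (simp add: run_kernel_def measure_pmf.prob_space_axioms)

lemma sets_run_measure [measurable_cong]:
  "sets (run_measure M s\<^sub>0 \<sigma>) = sets (PiM UNIV (\<lambda>_. count_space UNIV))"
proof -
  interpret Ionescu_Tulcea "run_kernel M s\<^sub>0 \<sigma>" "\<lambda>_. count_space UNIV"
    by (rule Ionescu_Tulcea_run_kernel)
  show ?thesis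
    by (simp add: run_measure_def)
qed

lemma space_run_measure: "space (run_measure M s\<^sub>0 \<sigma>) = UNIV"
  using sets_eq_imp_space_eq[OF sets_run_measure[of M s\<^sub>0 \<sigma>]] by (simp add: space_PiM)

lemma emeasure_run_measure_cylinder:
  "emeasure (run_measure M s\<^sub>0 \<sigma>) {\<rho>. \<forall>i\<le>n. \<rho> i = w i} =
     indicator {s\<^sub>0} (w 0) * (\<Prod>i<n. ennreal (pmf (next_state M \<sigma> (map w [0..<Suc i])) (w (Suc i))))"
proof -
  interpret Ionescu_Tulcea "run_kernel M s\<^sub>0 \<sigma>" "\<lambda>_. count_space UNIV"
    by (rule Ionescu_Tulcea_run_kernel)
  let ?M = "\<lambda>_::nat. count_space (UNIV :: 'a set)"
  let ?r = "\<lambda>n. restrict w {0..<n}"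
  have sing: "{?r n} \<in> sets (PiM {0..<n} ?M)" for n
    by (simp add: sets_PiM_countable_discrete)
  have Csing: "emeasure (C 0 n (\<lambda>_. undefined)) {?r n} =
      (\<Prod>i<n. emeasure (run_kernel M s\<^sub>0 \<sigma> i w) {w i})" for n
  proof (induction n)
    case 0
    show ?case using sing[of 0] by (simp add: restrict_def)
  next
    case (Suc n)
    have eP1: "emeasure (eP n x) {?r (Suc n)} =
        emeasure (run_kernel M s\<^sub>0 \<sigma> n w) {w n} * indicator {?r n} x"
      if x: "x \<in> space (PiM {0..<n} ?M)" for x
    proof -
      have ext: "x \<in> extensional {0..<n}" using x by (auto simp: space_PiM PiE_iff)
      have upd: "x(n := y) = ?r (Suc n) \<longleftrightarrow> x = ?r n \<and> y = w n" for y
      proof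
        assume eq: "x(n := y) = ?r (Suc n)"
        have "y = w n" using fun_cong[OF eq, of n] by simp
        moreover have "x = ?r n"
        proof
          show "x k = ?r n k" for k
          proof (cases "k < n")
            case True
            then show ?thesis using fun_cong[OF eq, of k] by simp
          next
            case False
            then show ?thesis using extensional_arb[OF ext, of k] by simp
          qed
        qed
        ultimately show "x = ?r n \<and> y = w n" by simp
      qed (auto simp: fun_eq_iff)
      have "emeasure (eP n x) {?r (Suc n)} =
          emeasure (run_kernel M s\<^sub>0 \<sigma> n x) {y. x(n := y) = ?r (Suc n)}"
        by (subst emeasure_eP[OF x sing]) (simp add: vimage_def)
      also have "\<dots> = emeasure (run_kernel M s\<^sub>0 \<sigma> n x) (if x = ?r n then {w n} else {})"
        by (intro arg_cong2[where f=emeasure]) (auto simp: upd)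
      also have "\<dots> = emeasure (run_kernel M s\<^sub>0 \<sigma> n w) {w n} * indicator {?r n} x"
      proof (cases "x = ?r n")
        case True
        have "map x [0..<n] = map w [0..<n]" using True by simp
        then have "run_kernel M s\<^sub>0 \<sigma> n x = run_kernel M s\<^sub>0 \<sigma> n w"
          by (simp only: run_kernel_def)
        then show ?thesis using True by simp
      qed simp
      finally show ?thesis .
    qed
    let ?C = "C 0 n (\<lambda>_. undefined)"
    have sp: "space ?C = space (PiM {0..<n} ?M)" and st: "sets ?C = sets (PiM {0..<n} ?M)"
      using space_C[of "\<lambda>_. undefined" 0 n] sets_C[of "\<lambda>_. undefined" 0 n] by (simp_all add: space_PiM)
    have meas: "eP n \<in> ?C \<rightarrow>\<^sub>M subprob_algebra (PiM {0..<Suc n} ?M)"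
      using measurable_eP[of n] by (simp cong: measurable_cong_sets add: measurable_cong_sets[OF st refl])
    have "emeasure (C 0 (Suc n) (\<lambda>_. undefined)) {?r (Suc n)} =
        (\<integral>\<^sup>+x. emeasure (eP n x) {?r (Suc n)} \<partial>?C)"
      using emeasure_bind[OF _ meas sing] sing[of n] by (simp add: sp)
    also have "\<dots> = (\<integral>\<^sup>+x. emeasure (run_kernel M s\<^sub>0 \<sigma> n w) {w n} * indicator {?r n} x \<partial>?C)"
      by (intro nn_integral_cong) (simp only: sp eP1)
    also have "\<dots> = emeasure (run_kernel M s\<^sub>0 \<sigma> n w) {w n} * emeasure ?C {?r n}"
      using sing[of n] by (intro nn_integral_cmult_indicator) (simp add: st)
    finally show ?case by (simp only: Suc.IH prod.lessThan_Suc mult.commute)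
  qed
  have "{\<rho>. \<forall>i\<le>n. \<rho> i = w i} = PF.emb UNIV {0..<Suc n} {?r (Suc n)}"
    by (auto simp: prod_emb_def fun_eq_iff restrict_def less_Suc_eq_le) metis
  then have "emeasure (run_measure M s\<^sub>0 \<sigma>) {\<rho>. \<forall>i\<le>n. \<rho> i = w i} =
      emeasure (CI {0..<Suc n}) {?r (Suc n)}"
    unfolding run_measure_def using lim[OF _ sing] by simp
  also have "\<dots> = emeasure (C 0 (Suc n) (\<lambda>_. undefined)) (PF.emb {0..<Suc n} {0..<Suc n} {?r (Suc n)})"
    by (rule emeasure_CI[OF subset_refl sing])
  also have "PF.emb {0..<Suc n} {0..<Suc n} {?r (Suc n)} = {?r (Suc n)}"
    by (rule prod_emb_id) (auto simp: PiE_iff)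
  also have "emeasure (C 0 (Suc n) (\<lambda>_. undefined)) {?r (Suc n)} =
      (\<Prod>i<Suc n. emeasure (run_kernel M s\<^sub>0 \<sigma> i w) {w i})"
    by (rule Csing)
  also have "\<dots> = indicator {s\<^sub>0} (w 0) *
      (\<Prod>i<n. ennreal (pmf (next_state M \<sigma> (map w [0..<Suc i])) (w (Suc i))))"
    by (subst prod.lessThan_Suc_shift)
       (simp add: run_kernel_def emeasure_pmf_single del: upt_Suc split: split_indicator)
  finally show ?thesis .
qed

lemma prob_space_run_measure: "prob_space (run_measure M s\<^sub>0 \<sigma>)"
proof -
  interpret Ionescu_Tulcea "run_kernel M s\<^sub>0 \<sigma>" "\<lambda>_. count_space UNIV"
    by (rule Ionescu_Tulcea_run_kernel)
  have "emeasure PF.lim (PF.emb UNIV {} {\<lambda>_. undefined}) = emeasure (CI {}) {\<lambda>_. undefined}"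
    by (rule lim) (simp_all add: sets_PiM_countable_discrete)
  also have "\<dots> = 1"
    using prob_space.emeasure_space_1[OF PF.prob_space_P[of "{}"]] by (simp add: CI_def space_PiM)
  also have "PF.emb UNIV {} {\<lambda>_. undefined} = space PF.lim"
    by (auto simp: prod_emb_def space_PiM)
  finally show ?thesis
    unfolding run_measure_def by (rule prob_spaceI)
qed

lemma MP_liminf_nonneg_measurable [measurable]:
  fixes M :: "('a::countable, 'z) mdp_scheme"
  shows "MP_liminf_nonneg M s\<^sub>0 \<in> sets (run_measure M s\<^sub>0 \<sigma>)"
proof -
  let ?N = "PiM UNIV (\<lambda>_::nat. count_space (UNIV :: 'a set))"
  have [measurable]: "(\<lambda>\<rho>. (\<rho> i, \<rho> (Suc i))) \<in> ?N \<rightarrow>\<^sub>M count_space UNIV" for i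
  proof -
    have "(\<lambda>\<rho>. (\<rho> i, \<rho> (Suc i))) \<in>
        ?N \<rightarrow>\<^sub>M count_space (UNIV :: 'a set) \<Otimes>\<^sub>M count_space (UNIV :: 'a set)"
      by measurable
    then show ?thesis
      by (simp add: pair_measure_countable)
  qed
  have [measurable]: "(\<lambda>\<rho>. rew M (\<rho> i, \<rho> (Suc i))) \<in> borel_measurable ?N" for i
    by (rule measurable_compose[of "\<lambda>\<rho>. (\<rho> i, \<rho> (Suc i))" _ "count_space UNIV"]) auto
  have [measurable]: "Measurable.pred ?N (\<lambda>\<rho>. (\<rho> i, \<rho> (Suc i)) \<in> transitions M)" for i
    by (rule measurable_compose[of "\<lambda>\<rho>. (\<rho> i, \<rho> (Suc i))" _ "count_space UNIV"]) auto
  have "{\<rho> \<in> space ?N. (\<rho> 0 = s\<^sub>0 \<and> (\<forall>i. (\<rho> i, \<rho> (Suc i)) \<in> transitions M)) \<and>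
      liminf (\<lambda>n. ereal (1 / real n * (\<Sum>j<n. rew M (\<rho> j, \<rho> (Suc j))))) \<ge> 0} \<in> sets ?N"
    by measurable
  then show ?thesis
    by (simp add: MP_liminf_nonneg_def runs_def sets_run_measure space_PiM)
qed

end

theory Submission
  imports Defs
begin

text \<open>The game is an infinite sequence of gadgets. In gadget \<open>n\<close> chance first picks a delay index
  \<open>i \<le> K\<close> and wastes \<open>delay n i\<close> steps. The player, who sees only that the delay is over, then picks
  \<open>j \<le> K\<close>. With probability \<open>r\<^bsup>j + 1\<^esup>\<close> the total reward crashes to at most minus the number of steps
  made so far; otherwise it dips to \<open>- depth n j\<close>, and in any case it then returns to 0. The dip is
  negligible against the elapsed time if \<open>j \<le> i\<close> and at least as large if \<open>j > i\<close>.

  Delay \<open>i\<close> has probability about \<open>r\<^bsup>K - i\<^esup>\<close>, so a player who counts steps and answers \<open>i\<close> by \<open>i\<close>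
  crashes with probability at most \<open>(K + 1) r\<^bsup>K + 1\<^esup>\<close>. A player with at most \<open>K\<close> memory modes enters
  the decision in the same mode for two delays \<open>i < i'\<close> with non-negligible probability; whatever
  \<open>j\<close> is then likely, either \<open>j > i\<close> is fatal for \<open>i\<close> or \<open>j < i'\<close> raises the crash probability at \<open>i'\<close>
  by a factor \<open>1 / r\<close>, and a bad event has probability of order \<open>r\<^bsup>K\<^esup>\<close>. Repeating each \<open>K\<close>
  about \<open>r\<^bsup>- K\<^esup>\<close> times makes the first bounds summable and the second ones not, for every number of modes.\<close>

section \<open>Extending histories\<close>

text \<open>The law of a history prolonged by \<open>t\<close> steps of a history-dependent kernel.
  Starting from an arbitrary history \<open>h\<close> instead of a single state lets the process be
  restarted at random times; it serves both for runs and for the chain of modes and states.\<close>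

primrec hist :: "('x list \<Rightarrow> 'x pmf) \<Rightarrow> 'x list \<Rightarrow> nat \<Rightarrow> 'x list pmf" where
  "hist K h 0 = return_pmf h"
| "hist K h (Suc t) = bind_pmf (hist K h t) (\<lambda>w. map_pmf (\<lambda>x. w @ [x]) (K w))"

lemma hist_add: "hist K h (s + t) = bind_pmf (hist K h s) (\<lambda>w. hist K w t)"
  by (induction t) (simp_all add: bind_return_pmf' bind_assoc_pmf)

lemma hist_Suc_left: "hist K h (Suc t) = bind_pmf (K h) (\<lambda>x. hist K (h @ [x]) t)"
  using hist_add[of K h 1 t] by (simp add: bind_return_pmf bind_map_pmf)

lemma hist_extends:
  assumes "w \<in> set_pmf (hist K h t)"
  obtains u where "w = h @ u" "length u = t"
proof -
  have "\<exists>u. w = h @ u \<and> length u = t"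
    using assms(1)
  proof (induction t arbitrary: w)
    case (Suc t)
    then obtain v x where v: "v \<in> set_pmf (hist K h t)" "w = v @ [x]" by auto
    with Suc.IH[OF v(1)] show ?case by auto
  qed simp
  with that show thesis by blast
qed

lemma length_hist: "w \<in> set_pmf (hist K h t) \<Longrightarrow> length w = length h + t"
  by (metis hist_extends length_append)

text \<open>The Markov property at the random time \<open>1 + f x\<close>, determined by the first
  step \<open>x\<close>. The stopped history \<open>w\<close> carries the time in its length, so
  \<open>Suc t + length h - length w\<close> is the number \<open>t - f x\<close> of steps
  left.\<close>

lemma hist_Suc_stop:
  assumes "\<And>x. x \<in> set_pmf (K h) \<Longrightarrow> f x \<le> t"
  shows "hist K h (Suc t) =
    bind_pmf (bind_pmf (K h) (\<lambda>x. hist K (h @ [x]) (f x))) (\<lambda>w. hist K w (Suc t + length h - length w))"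
proof -
  have "hist K (h @ [x]) t =
      bind_pmf (hist K (h @ [x]) (f x)) (\<lambda>w. hist K w (Suc t + length h - length w))"
    if x: "x \<in> set_pmf (K h)" for x
  proof -
    have "hist K (h @ [x]) t = hist K (h @ [x]) (f x + (t - f x))"
      using assms[OF x] by simp
    also have "\<dots> = bind_pmf (hist K (h @ [x]) (f x)) (\<lambda>w. hist K w (t - f x))"
      by (rule hist_add)
    also have "\<dots> = bind_pmf (hist K (h @ [x]) (f x)) (\<lambda>w. hist K w (Suc t + length h - length w))"
      by (intro bind_pmf_cong refl) (auto dest!: length_hist)
    finally show ?thesis .
  qed
  then show ?thesis
    unfolding hist_Suc_left bind_assoc_pmf by (intro bind_pmf_cong) auto
qed

lemma hist_supermartingale:
  fixes V :: "'x list \<Rightarrow> ennreal"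
  assumes "\<And>w. w \<noteq> [] \<Longrightarrow> (\<integral>\<^sup>+x. V (w @ [x]) \<partial>measure_pmf (K w)) \<le> V w" "h \<noteq> []"
  shows "(\<integral>\<^sup>+w. V w \<partial>hist K h t) \<le> V h"
proof (induction t)
  case (Suc t)
  have "(\<integral>\<^sup>+w. V w \<partial>hist K h (Suc t)) = (\<integral>\<^sup>+w. (\<integral>\<^sup>+x. V (w @ [x]) \<partial>measure_pmf (K w)) \<partial>hist K h t)"
    by simp
  also have "\<dots> \<le> (\<integral>\<^sup>+w. V w \<partial>hist K h t)"
  proof (intro nn_integral_mono_AE, unfold AE_measure_pmf_iff, intro ballI assms(1))
    show "w \<noteq> []" if "w \<in> set_pmf (hist K h t)" for w
      using assms(2) length_hist[OF that] by auto
  qed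
  finally show ?case using Suc by simp
qed simp

lemma measure_bind_pmf_ge:
  assumes "\<And>x. x \<in> X \<Longrightarrow> x \<in> set_pmf p \<Longrightarrow> measure (measure_pmf (f x)) B \<ge> c" "c \<ge> 0"
  shows "measure (bind_pmf p f) B \<ge> measure p X * c"
proof -
  have "ennreal (measure p X * c) = (\<integral>\<^sup>+x. ennreal c * indicator X x \<partial>p)"
    using assms(2) by (simp add: nn_integral_cmult_indicator ennreal_mult' measure_pmf.emeasure_eq_measure mult.commute)
  also have "\<dots> \<le> (\<integral>\<^sup>+x. emeasure (measure_pmf (f x)) B \<partial>p)"
    using assms(1) by (intro nn_integral_mono_AE)
      (auto simp: AE_measure_pmf_iff measure_pmf.emeasure_eq_measure split: split_indicator intro!: ennreal_leI)
  also have "\<dots> = ennreal (measure (bind_pmf p f) B)"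
    by (simp add: measure_pmf.emeasure_eq_measure[symmetric])
  finally show ?thesis by simp
qed

lemma pmf_hist_snoc:
  "pmf (bind_pmf p (\<lambda>w. map_pmf (\<lambda>x. w @ [x]) (K w))) (v @ [y]) = pmf p v * pmf (K v) y"
proof -
  have "pmf (map_pmf (\<lambda>x. w @ [x]) (K w)) (v @ [y]) = pmf (K v) y * indicator {v} w" for w
  proof (cases "w = v")
    case True
    have "pmf (map_pmf (\<lambda>x. v @ [x]) (K v)) (v @ [y]) = pmf (K v) y"
      by (rule pmf_map_inj') (simp add: inj_def)
    with True show ?thesis by simp
  next
    case False
    then have "v @ [y] \<notin> set_pmf (map_pmf (\<lambda>x. w @ [x]) (K w))" by auto
    with False show ?thesis by (simp add: pmf_eq_0_set_pmf)
  qed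
  then have "pmf (bind_pmf p (\<lambda>w. map_pmf (\<lambda>x. w @ [x]) (K w))) (v @ [y]) =
      (\<integral>w. pmf (K v) y * indicator {v} w \<partial>p)"
    by (simp add: pmf_bind)
  also have "\<dots> = pmf p v * pmf (K v) y"
    by (simp add: measure_pmf_single)
  finally show ?thesis .
qed

lemma pmf_hist:
  "length w = Suc t \<Longrightarrow>
   pmf (hist K [s] t) w = indicator {s} (w ! 0) * (\<Prod>i<t. pmf (K (take (Suc i) w)) (w ! Suc i))"
proof (induction t arbitrary: w)
  case 0
  then show ?case by (cases w) (auto simp: indicator_def)
next
  case (Suc t)
  obtain v y where w: "w = v @ [y]" "length v = Suc t"
    using Suc.prems by (cases w rule: rev_cases) auto
  have "(\<Prod>i<t. pmf (K (take (Suc i) w)) (w ! Suc i)) = (\<Prod>i<t. pmf (K (take (Suc i) v)) (v ! Suc i))"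
    using w by (intro prod.cong refl) (auto simp: nth_append)
  with w Suc.IH[of v] show ?case
    by (simp add: pmf_hist_snoc nth_append)
qed

section \<open>Laws of finite prefixes under the run measure\<close>

lemma measurable_run_prefix [measurable]:
  "(\<lambda>\<rho>. map \<rho> [0..<n]) \<in> run_measure (M :: ('a::countable, 'z) mdp_scheme) s\<^sub>0 \<sigma> \<rightarrow>\<^sub>M count_space UNIV"
proof -
  have "(\<lambda>\<rho>. map \<rho> [0..<n]) -` {w} \<inter> space (run_measure M s\<^sub>0 \<sigma>) \<in> sets (run_measure M s\<^sub>0 \<sigma>)"
    for w :: "'a list"
  proof (cases "length w = n")
    case True
    then have "(\<lambda>\<rho>. map \<rho> [0..<n]) -` {w} \<inter> space (run_measure M s\<^sub>0 \<sigma>) =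
        {\<rho> \<in> space (PiM UNIV (\<lambda>_. count_space UNIV)). \<forall>i\<in>{..<n}. \<rho> i = w ! i}"
      by (auto simp: space_run_measure space_PiM list_eq_iff_nth_eq[of _ w])
    also have "\<dots> \<in> sets (run_measure M s\<^sub>0 \<sigma>)"
      unfolding sets_run_measure by measurable
    finally show ?thesis .
  next
    case False
    then have "(\<lambda>\<rho>. map \<rho> [0..<n]) -` {w} = {}" by auto
    then show ?thesis by simp
  qed
  then show ?thesis
    by (subst measurable_count_space_eq2_countable) auto
qed

text \<open>Lists of states are countable, so agreement on singletons suffices, and there the
  cylinder formula matches \<open>pmf_hist\<close>. Events about finite prefixes thereby become
  computations with pmfs.\<close>

lemma distr_run_prefix:
  fixes M :: "('a::countable, 'z) mdp_scheme"
  shows "distr (run_measure M s\<^sub>0 \<sigma>) (count_space UNIV) (\<lambda>\<rho>. map \<rho> [0..<Suc t]) =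
    measure_pmf (hist (next_state M \<sigma>) [s\<^sub>0] t)"
proof (rule measure_eqI_countable[of _ UNIV])
  fix w :: "'a list"
  let ?R = "run_measure M s\<^sub>0 \<sigma>" and ?f = "\<lambda>\<rho>. map \<rho> [0..<Suc t]"
  have e: "emeasure (distr ?R (count_space UNIV) ?f) {w} = emeasure ?R {\<rho>. ?f \<rho> = w}"
    by (subst emeasure_distr[OF measurable_run_prefix]) (auto simp: space_run_measure vimage_def)
  show "emeasure (distr ?R (count_space UNIV) ?f) {w} =
      emeasure (hist (next_state M \<sigma>) [s\<^sub>0] t) {w}"
  proof (cases "length w = Suc t")
    case True
    have "{\<rho>. ?f \<rho> = w} = {\<rho>. \<forall>i\<le>t. \<rho> i = w ! i}"
      using True by (auto simp: list_eq_iff_nth_eq less_Suc_eq_le simp del: upt_Suc)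
    moreover have "map ((!) w) [0..<Suc i] = take (Suc i) w" if "i < t" for i
      using True that by (auto simp: list_eq_iff_nth_eq simp del: upt_Suc)
    ultimately show ?thesis
      using True by (simp add: e emeasure_run_measure_cylinder emeasure_pmf_single pmf_hist
          prod_ennreal ennreal_mult'' prod_nonneg ennreal_indicator del: upt_Suc)
  next
    case False
    then have "w \<notin> set_pmf (hist (next_state M \<sigma>) [s\<^sub>0] t)"
      by (auto dest: length_hist)
    moreover have "{\<rho>. ?f \<rho> = w} = {}"
      using False by auto
    ultimately show ?thesis
      unfolding e by (simp add: emeasure_pmf_single set_pmf_iff)
  qed
qed auto

lemma sets_run_prefix [measurable]:
  fixes M :: "('a::countable, 'z) mdp_scheme"
  shows "{\<rho>. P (map \<rho> [0..<n])} \<in> sets (run_measure M s\<^sub>0 \<sigma>)"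
proof -
  have "{\<rho> \<in> space (run_measure M s\<^sub>0 \<sigma>). P (map \<rho> [0..<n])} \<in> sets (run_measure M s\<^sub>0 \<sigma>)"
    by measurable
  then show ?thesis by (simp add: space_run_measure)
qed

lemma emeasure_run_prefix:
  fixes M :: "('a::countable, 'z) mdp_scheme"
  shows "emeasure (run_measure M s\<^sub>0 \<sigma>) {\<rho>. P (map \<rho> [0..<Suc t])} =
    emeasure (hist (next_state M \<sigma>) [s\<^sub>0] t) {w. P w}"
  unfolding distr_run_prefix[symmetric]
  by (subst emeasure_distr[OF measurable_run_prefix]) (auto simp: space_run_measure vimage_def)

lemma hist_nth_Suc:
  assumes "w \<in> set_pmf (hist K [s] t)"
  shows "w ! 0 = s" "i < t \<Longrightarrow> w ! Suc i \<in> set_pmf (K (take (Suc i) w))"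
proof -
  have "length w = Suc t" using length_hist[OF assms] by simp
  with assms have "indicator {s} (w ! 0) * (\<Prod>i<t. pmf (K (take (Suc i) w)) (w ! Suc i)) \<noteq> (0::real)"
    by (simp add: set_pmf_iff pmf_hist)
  then show "w ! 0 = s" "i < t \<Longrightarrow> w ! Suc i \<in> set_pmf (K (take (Suc i) w))"
    by (auto simp: set_pmf_iff indicator_def split: if_splits)
qed

text \<open>Every prefix lies almost surely in the support of its law, and countably many null sets
  can be removed at once. This allows pathwise arguments about almost every run.\<close>

lemma AE_run_measure_steps:
  fixes M :: "('a::countable, 'z) mdp_scheme"
  shows "AE \<rho> in run_measure M s\<^sub>0 \<sigma>. \<rho> 0 = s\<^sub>0 \<and>
    (\<forall>i. \<rho> (Suc i) \<in> set_pmf (next_state M \<sigma> (map \<rho> [0..<Suc i])))"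
proof -
  let ?R = "run_measure M s\<^sub>0 \<sigma>"
  have "AE \<rho> in ?R. map \<rho> [0..<Suc t] \<in> set_pmf (hist (next_state M \<sigma>) [s\<^sub>0] t)" for t
  proof -
    have "AE w in distr ?R (count_space UNIV) (\<lambda>\<rho>. map \<rho> [0..<Suc t]).
        w \<in> set_pmf (hist (next_state M \<sigma>) [s\<^sub>0] t)"
      unfolding distr_run_prefix by (simp add: AE_measure_pmf_iff)
    then show ?thesis
      by (subst (asm) AE_distr_iff) auto
  qed
  then have "AE \<rho> in ?R. \<forall>t. map \<rho> [0..<Suc t] \<in> set_pmf (hist (next_state M \<sigma>) [s\<^sub>0] t)"
    by (simp add: AE_all_countable)
  then show ?thesis
  proof eventually_elim
    case (elim \<rho>)
    have "\<rho> 0 = s\<^sub>0" using elim[rule_format, of 0] by simp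
    moreover have "\<rho> (Suc i) \<in> set_pmf (next_state M \<sigma> (map \<rho> [0..<Suc i]))" for i
      using hist_nth_Suc(2)[OF elim[rule_format, of "Suc i"], of i]
      by (simp add: take_map nth_append del: upt_Suc)
    ultimately show ?case by blast
  qed
qed

section \<open>Finite-memory strategies as projections of a Markov chain\<close>

lemma memory_chain_eq_hist:
  "memory_chain \<tau> m s t = hist (\<lambda>h. \<tau> (fst (last h)) (snd (last h))) [(m, s)] t"
  by (induction t) (simp_all add: case_prod_beta)

lemma bind_cond_map_pmf: "bind_pmf (map_pmf f p) (\<lambda>y. cond_pmf p {x. f x = y}) = p"
  by (rule bind_cond_pmf_cancel[where R="\<lambda>y x. f x = y"]) (auto simp: vimage_def)

lemma memory_chain_partial_run:
  assumes "is_mdp M" "memory_structure M Q \<tau>" "m \<in> Q" "s \<in> states M"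
    "h \<in> set_pmf (memory_chain \<tau> m s t)"
  shows "partial_run M (map snd h) \<and> h \<noteq> [] \<and> hd h = (m, s) \<and> fst (last h) \<in> Q"
  using assms(5)
proof (induction t arbitrary: h)
  case 0
  then show ?case using assms by (simp add: partial_run_def)
next
  case (Suc t)
  then obtain h' x where h: "h = h' @ [x]" "h' \<in> set_pmf (memory_chain \<tau> m s t)"
      "x \<in> set_pmf (\<tau> (fst (last h')) (snd (last h')))"
    by (auto simp: case_prod_beta)
  note IH = Suc.IH[OF h(2)]
  then have "snd (last h') \<in> states M"
    by (auto simp: partial_run_def)
  then have x: "fst x \<in> Q" "(snd (last h'), snd x) \<in> transitions M"
    using assms(2) h(3) IH unfolding memory_structure_def by fastforce+
  then have "snd x \<in> states M" using assms(1) by (auto simp: is_mdp_def)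
  then show ?case
    using IH x h(1) by (auto simp: partial_run_def successively_append_iff last_map)
qed

text \<open>Given the visited states \<open>w\<close>, \<open>induced_strategy\<close> averages the
  next choice over the conditional law of the mode; integrating over \<open>w\<close> undoes the
  conditioning. At random states every mode prescribes the same law, that of \<open>prob M\<close>.
  Finite memory is thus reduced to a Markov chain on modes and states.\<close>

lemma FR_law:
  assumes mdp: "is_mdp M" and ms: "memory_structure M Q \<tau>" and m: "m \<in> Q" and s: "s \<in> states M"
    and ind: "\<And>w. partial_run M w \<Longrightarrow> last w \<in> controlled M \<Longrightarrow> memory_compatible \<tau> m w \<Longrightarrow>
      \<sigma> w = induced_strategy \<tau> m w"
  shows "hist (next_state M \<sigma>) [s] t = map_pmf (map snd) (memory_chain \<tau> m s t)"
proof (induction t)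
  case (Suc t)
  let ?p = "memory_chain \<tau> m s t"
  let ?g = "\<lambda>h. map_pmf snd (\<tau> (fst (last h)) (snd (last h)))"
  have next_eq: "next_state M \<sigma> w = bind_pmf (cond_pmf ?p {h. map snd h = w}) ?g"
    if w: "w \<in> set_pmf (map_pmf (map snd) ?p)" for w
  proof -
    obtain h where h: "h \<in> set_pmf ?p" "map snd h = w" using w by auto
    note pr = memory_chain_partial_run[OF mdp ms m s]
    have ne: "set_pmf ?p \<inter> {h. map snd h = w} \<noteq> {}" using h by auto
    have w': "partial_run M w" "hd w = s" "length w - 1 = t"
      using pr[OF h(1)] h length_hist[of h] unfolding memory_chain_eq_hist
      by (auto simp: hd_map)
    have lst: "snd (last h) = last w" "fst (last h) \<in> Q"
      if "h \<in> set_pmf (cond_pmf ?p {h. map snd h = w})" for h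
      using that pr[of h] by (auto simp: set_cond_pmf[OF ne] last_map)
    show ?thesis
    proof (cases "last w \<in> controlled M")
      case True
      have "memory_compatible \<tau> m w"
        using ne w' by (simp add: memory_compatible_def)
      then have "next_state M \<sigma> w = induced_strategy \<tau> m w"
        using True w' ind by (simp add: next_state_def)
      also have "\<dots> = bind_pmf (cond_pmf ?p {h. map snd h = w}) ?g"
        unfolding induced_strategy_def w' using lst by (intro bind_pmf_cong) auto
      finally show ?thesis .
    next
      case False
      have "last w \<in> states M" using w' by (auto simp: partial_run_def)
      then have "?g h = prob M (last w)" if "h \<in> set_pmf (cond_pmf ?p {h. map snd h = w})" for h
        using lst[OF that] False ms unfolding memory_structure_def by auto
      then have "bind_pmf (cond_pmf ?p {h. map snd h = w}) ?g =
          bind_pmf (cond_pmf ?p {h. map snd h = w}) (\<lambda>_. prob M (last w))"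
        by (intro bind_pmf_cong) auto
      then show ?thesis using False by (simp add: next_state_def)
    qed
  qed
  have "hist (next_state M \<sigma>) [s] (Suc t) =
      bind_pmf (map_pmf (map snd) ?p)
        (\<lambda>w. bind_pmf (cond_pmf ?p {h. map snd h = w}) (\<lambda>h. map_pmf (\<lambda>x. w @ [x]) (?g h)))"
    by (simp only: hist.simps Suc.IH) (intro bind_pmf_cong refl, simp only: next_eq map_bind_pmf)
  \<comment> \<open>Under the conditional law \<open>w\<close> equals \<open>map snd h\<close>;
    after this replacement \<open>w\<close> survives only in the conditioning, and the
    disintegration of \<open>?p\<close> collapses.\<close>
  also have "\<dots> = bind_pmf (map_pmf (map snd) ?p)
        (\<lambda>w. bind_pmf (cond_pmf ?p {h. map snd h = w}) (\<lambda>h. map_pmf (\<lambda>x. map snd h @ [x]) (?g h)))"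
    by (intro bind_pmf_cong refl) (subst (asm) set_cond_pmf, auto)
  also have "\<dots> = bind_pmf ?p (\<lambda>h. map_pmf (\<lambda>x. map snd h @ [x]) (?g h))"
    by (simp only: bind_assoc_pmf[symmetric] bind_cond_map_pmf)
  also have "\<dots> = map_pmf (map snd) (memory_chain \<tau> m s (Suc t))"
    by (simp add: map_bind_pmf pmf.map_comp comp_def case_prod_beta)
  finally show ?case .
qed simp

section \<open>Parameters of the gadgets\<close>

text \<open>The exponent 5 balances two products with the block length \<open>(K+1)^(5K+2)\<close>:
  times \<open>fail_bound K\<close> it gives \<open>1 / (K+1)^2\<close>, which is summable, and
  times \<open>confusion m K\<close> it gives \<open>1 / m\<close> for every \<open>K\<close>, which
  is not.\<close>

definition ratio :: "nat \<Rightarrow> real" where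
  "ratio K = 1 / real (Suc K) ^ 5"

primrec block_start :: "nat \<Rightarrow> nat" where
  "block_start 0 = 0"
| "block_start (Suc K) = block_start K + Suc K ^ (5 * K + 2)"

definition level :: "nat \<Rightarrow> nat" where
  "level n = (LEAST K. n < block_start (Suc K))"

lemma ratio_pos: "0 < ratio K" and ratio_le_1: "ratio K \<le> 1"
  by (simp_all add: ratio_def)

lemma mono_block_start: "mono block_start"
  by (rule mono_onI, rule lift_Suc_mono_le) auto

lemma block_start_ge: "K \<le> block_start K"
proof (induction K)
  case (Suc K)
  have "1 \<le> Suc K ^ (5 * K + 2)" by (rule one_le_power) simp
  with Suc show ?case by simp
qed simp

lemma level_eqI:
  assumes "block_start K \<le> n" "n < block_start (Suc K)"
  shows "level n = K"
  unfolding level_def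
proof (rule Least_equality)
  fix L assume n: "n < block_start (Suc L)"
  show "K \<le> L"
  proof (rule ccontr)
    assume "\<not> K \<le> L"
    then have "block_start (Suc L) \<le> block_start K"
      by (intro monoD[OF mono_block_start]) simp
    with assms n show False by simp
  qed
qed fact

lemma level_ge: "block_start K \<le> n \<Longrightarrow> K \<le> level n"
proof (rule ccontr)
  assume K: "block_start K \<le> n" "\<not> K \<le> level n"
  \<comment> \<open>The \<open>LEAST\<close> in \<open>level\<close> is attained because
    \<open>block_start\<close> dominates the identity.\<close>
  have "n < block_start (Suc n)"
    using block_start_ge[of "Suc n"] by simp
  then have "n < block_start (Suc (level n))"
    unfolding level_def by (rule LeastI)
  also have "\<dots> \<le> block_start K"
    using K(2) by (intro monoD[OF mono_block_start]) simp
  finally show False using K(1) by simp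
qed

text \<open>Grouping by blocks: block \<open>L\<close> contributes as many equal terms as it is
  long.\<close>

lemma sum_level:
  fixes f :: "nat \<Rightarrow> real"
  shows "(\<Sum>n\<in>{block_start K..<block_start (K + r)}. f (level n)) =
    (\<Sum>L\<in>{K..<K + r}. real (Suc L) ^ (5 * L + 2) * f L)"
proof (induction r)
  case (Suc r)
  let ?L = "K + r"
  have "(\<Sum>n\<in>{block_start ?L..<block_start (Suc ?L)}. f (level n)) =
      (\<Sum>n\<in>{block_start ?L..<block_start (Suc ?L)}. f ?L)"
    by (intro sum.cong refl) (metis atLeastLessThan_iff level_eqI)
  also have "\<dots> = real (Suc ?L) ^ (5 * ?L + 2) * f ?L"
    by (simp only: sum_constant card_atLeastLessThan block_start.simps add_diff_cancel_left'
        of_nat_power)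
  finally have last: "(\<Sum>n\<in>{block_start ?L..<block_start (Suc ?L)}. f (level n)) =
      real (Suc ?L) ^ (5 * ?L + 2) * f ?L" .
  have le: "block_start K \<le> block_start ?L" "block_start ?L \<le> block_start (Suc ?L)"
    by (auto intro!: monoD[OF mono_block_start])
  show ?case
    using sum.atLeastLessThan_concat[OF le, of "\<lambda>n. f (level n)"] unfolding Suc.IH last
    by (simp del: block_start.simps of_nat_Suc power_Suc power_add)
qed simp

definition fail_bound :: "nat \<Rightarrow> real" where
  "fail_bound K = real (Suc K) * ratio K ^ Suc K"

lemma fail_bound_nonneg: "0 \<le> fail_bound K"
  using ratio_pos[of K] by (simp add: fail_bound_def)

lemma summable_fail_bound: "summable (\<lambda>n. fail_bound (level n))"
proof (rule summableI_nonneg_bounded)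
  fix N
  have sq: "real (Suc L) ^ (5 * L + 2) * fail_bound L = 1 / real (Suc L) ^ 2" for L
  proof -
    have "real (Suc L) ^ (5 * L + 2) * fail_bound L * real (Suc L) ^ 2 =
        real (Suc L) ^ (5 * L + 5) * ratio L ^ Suc L"
      by (simp add: fail_bound_def power_add eval_nat_numeral)
    also have "real (Suc L) ^ (5 * L + 5) = (real (Suc L) ^ 5) ^ Suc L"
      by (simp only: power_mult[symmetric]) (simp add: algebra_simps)
    also have "\<dots> * ratio L ^ Suc L = 1"
      by (simp only: power_mult_distrib[symmetric]) (simp add: ratio_def)
    finally show ?thesis by (simp add: field_simps del: of_nat_Suc)
  qed
  have sm: "summable (\<lambda>L. 1 / real (Suc L) ^ 2)"
    using inverse_power_summable[of 2, where ?'a=real] by (subst summable_Suc_iff) (simp add: inverse_eq_divide)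
  have "(\<Sum>n<N. fail_bound (level n)) \<le> (\<Sum>n\<in>{block_start 0..<block_start (0 + N)}. fail_bound (level n))"
    using block_start_ge[of N] by (intro sum_mono2) (auto simp: fail_bound_nonneg)
  also have "\<dots> = (\<Sum>L<N. 1 / real (Suc L) ^ 2)"
    unfolding sum_level sq by (simp add: atLeast0LessThan)
  also have "\<dots> \<le> (\<Sum>L. 1 / real (Suc L) ^ 2)"
    by (rule sum_le_suminf[OF sm]) auto
  finally show "(\<Sum>n<N. fail_bound (level n)) \<le> (\<Sum>L. 1 / real (Suc L) ^ 2)" .
qed (rule fail_bound_nonneg)

text \<open>The block of gadgets of level \<open>K\<close> has length \<open>1 / confusion 1 K\<close>.\<close>

definition confusion :: "nat \<Rightarrow> nat \<Rightarrow> real" where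
  "confusion m K = ratio K ^ K / (real m * real (Suc K) ^ 2)"

lemma confusion_le_1: "confusion m K \<le> 1"
\<comment> \<open>For \<open>m = 0\<close> the quotient is 0 by convention.\<close>
proof (cases "m = 0")
  case False
  have "ratio K ^ K \<le> 1"
    using ratio_pos[of K] ratio_le_1[of K] by (simp add: power_le_one)
  also have "1 \<le> real m * real (Suc K) ^ 2"
    using False mult_mono[of 1 "real m" 1 "real (Suc K) ^ 2"] by (simp add: one_le_power)
  finally show ?thesis using False by (simp add: confusion_def)
qed (simp add: confusion_def)

text \<open>By \<open>1 - x \<le> exp (- x)\<close>, since the confusions of each of the
  \<open>r\<close> blocks add up to \<open>1 / m\<close>.\<close>

lemma prod_confusion_le:
  "(\<Prod>n\<in>{block_start K..<block_start (K + r)}. 1 - confusion m (level n)) \<le> exp (- (real r / real m))"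
proof -
  have one: "real (Suc L) ^ (5 * L + 2) * confusion m L = 1 / real m" for L
  proof -
    have "real (Suc L) ^ (5 * L + 2) * confusion m L =
        ((real (Suc L) ^ 5) ^ L * ratio L ^ L) * (real (Suc L) ^ 2 / real (Suc L) ^ 2) / real m"
      unfolding confusion_def by (simp only: power_mult[symmetric] power_add) simp
    also have "(real (Suc L) ^ 5) ^ L * ratio L ^ L = 1"
      by (simp only: power_mult_distrib[symmetric]) (simp add: ratio_def)
    finally show ?thesis by simp
  qed
  have "(\<Prod>n\<in>{block_start K..<block_start (K + r)}. 1 - confusion m (level n)) \<le>
      (\<Prod>n\<in>{block_start K..<block_start (K + r)}. exp (- confusion m (level n)))"
    using exp_ge_add_one_self[of "- confusion m _"]
    by (intro prod_mono) (auto simp: confusion_le_1)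
  also have "\<dots> = exp (- (\<Sum>n\<in>{block_start K..<block_start (K + r)}. confusion m (level n)))"
    by (simp add: exp_sum sum_negf[symmetric])
  also have "(\<Sum>n\<in>{block_start K..<block_start (K + r)}. confusion m (level n)) = real r / real m"
    unfolding sum_level one by simp
  finally show ?thesis by simp
qed

text \<open>The weight \<open>ratio K ^ (K - i)\<close> is matched to the crash probability
  \<open>ratio K ^ (i + 1)\<close> of the answer \<open>i\<close>: their product does not depend on
  \<open>i\<close>, so no delay is preferable to another.\<close>

definition delay_pmf :: "nat \<Rightarrow> nat pmf" where
  "delay_pmf K = embed_pmf (\<lambda>i. if i \<le> K then ratio K ^ (K - i) / (\<Sum>l\<le>K. ratio K ^ l) else 0)"

lemma ratio_sum_ge_1: "1 \<le> (\<Sum>l\<le>K. ratio K ^ l)"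
  and ratio_sum_le: "(\<Sum>l\<le>K. ratio K ^ l) \<le> real (Suc K)"
proof -
  have "(\<Sum>l\<in>{0}. ratio K ^ l) \<le> (\<Sum>l\<le>K. ratio K ^ l)"
    using ratio_pos[of K] by (intro sum_mono2) auto
  then show "1 \<le> (\<Sum>l\<le>K. ratio K ^ l)" by simp
  have "(\<Sum>l\<le>K. ratio K ^ l) \<le> (\<Sum>l\<le>K. 1)"
    using ratio_pos[of K] ratio_le_1[of K] by (intro sum_mono power_le_one) auto
  then show "(\<Sum>l\<le>K. ratio K ^ l) \<le> real (Suc K)" by simp
qed

lemma pmf_delay:
  "pmf (delay_pmf K) i = (if i \<le> K then ratio K ^ (K - i) / (\<Sum>l\<le>K. ratio K ^ l) else 0)"
  unfolding delay_pmf_def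
proof (rule pmf_embed_pmf)
  let ?Z = "\<Sum>l\<le>K. ratio K ^ l"
  let ?f = "\<lambda>i. if i \<le> K then ratio K ^ (K - i) / ?Z else 0"
  note Z = ratio_sum_ge_1[of K]
  show nn: "0 \<le> ?f i" for i
    using Z ratio_pos[of K] by simp
  have "(\<integral>\<^sup>+i. ennreal (?f i) \<partial>count_space UNIV) = (\<Sum>i\<le>K. ennreal (?f i))"
    by (rule nn_integral_count_space') auto
  also have "\<dots> = ennreal (\<Sum>i\<le>K. ?f i)"
    by (rule sum_ennreal) (rule nn)
  also have "(\<Sum>i\<le>K. ?f i) = (\<Sum>i\<le>K. ratio K ^ (K - i)) / ?Z"
    by (simp add: sum_divide_distrib)
  also have "(\<Sum>i\<le>K. ratio K ^ (K - i)) = ?Z"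
    by (rule sum.nat_diff_reindex[of _ "Suc K", unfolded lessThan_Suc_atMost, simplified])
  finally show "(\<integral>\<^sup>+i. ennreal (?f i) \<partial>count_space UNIV) = 1" using Z by simp
qed

lemma set_delay_pmf: "set_pmf (delay_pmf K) = {..K}"
  using ratio_pos[of K] ratio_sum_ge_1[of K] by (auto simp: set_pmf_iff pmf_delay split: if_splits)

lemma pmf_delay_le: "i \<le> K \<Longrightarrow> pmf (delay_pmf K) i \<le> ratio K ^ (K - i)"
  using ratio_sum_ge_1[of K] ratio_pos[of K]
  by (simp add: pmf_delay divide_le_eq mult_le_cancel_left1)

lemma pmf_delay_ge: "i \<le> K \<Longrightarrow> ratio K ^ (K - i) / real (Suc K) \<le> pmf (delay_pmf K) i"
  using ratio_sum_ge_1[of K] ratio_sum_le[of K] ratio_pos[of K]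
  by (simp add: pmf_delay) (intro divide_left_mono, auto)

text \<open>A run enters gadget \<open>n\<close> after at most \<open>arrival n - 3\<close> steps, hence after delay \<open>i\<close> it reaches
  the dip no later than at time \<open>arrival n + delay n i = depth n (i + 1)\<close>.\<close>

primrec dip :: "nat \<Rightarrow> nat \<Rightarrow> nat \<Rightarrow> nat" where
  "dip a n 0 = 0"
| "dip a n (Suc i) = a + Suc n * dip a n i"

primrec arrival :: "nat \<Rightarrow> nat" where
  "arrival 0 = 3"
| "arrival (Suc n) = arrival n + 4 + Suc n * dip (arrival n) n (level n)"

text \<open>The first argument of \<open>dip\<close> stands for \<open>arrival n\<close>. Leaving it
  free makes \<open>arrival\<close> primitive recursive although arrival times and depths depend on
  each other.\<close>

definition depth :: "nat \<Rightarrow> nat \<Rightarrow> nat" where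
  "depth n = dip (arrival n) n"

text \<open>The factor \<open>Suc n\<close> keeps the average loss of a dip
  \<open>depth n j\<close>, taken at a time of at least \<open>delay n j\<close>, below
  \<open>1 / Suc n\<close>.\<close>

definition delay :: "nat \<Rightarrow> nat \<Rightarrow> nat" where
  "delay n i = Suc n * depth n i"

lemma arrival_ge: "3 \<le> arrival n"
  by (induction n) auto

lemma mono_arrival: "mono arrival"
  by (rule mono_onI, rule lift_Suc_mono_le) auto

lemma depth_Suc: "depth n (Suc i) = arrival n + delay n i"
  by (simp add: depth_def delay_def)

lemma arrival_Suc: "arrival (Suc n) = arrival n + 4 + delay n (level n)"
  by (simp add: depth_def delay_def)

lemma delay_0 [simp]: "delay n 0 = 0"
  by (simp add: depth_def delay_def)

lemma strict_mono_depth: "strict_mono (depth n)"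
proof (rule strict_monoI_Suc)
  show "depth n i < depth n (Suc i)" for i
    using arrival_ge[of n] by (simp add: depth_def)
qed

lemma strict_mono_delay: "strict_mono (delay n)"
  unfolding delay_def by (intro strict_monoI mult_strict_left_mono strict_monoD[OF strict_mono_depth]) auto

lemma depth_mono: "i \<le> j \<Longrightarrow> depth n i \<le> depth n j"
  using strict_mono_less_eq[OF strict_mono_depth] by blast

lemma delay_mono: "i \<le> j \<Longrightarrow> delay n i \<le> delay n j"
  using strict_mono_less_eq[OF strict_mono_delay] by blast

lemma inj_delay: "delay n i = delay n j \<longleftrightarrow> i = j"
  by (rule strict_mono_eq[OF strict_mono_delay])

section \<open>The game and a winning strategy with infinite memory\<close>

datatype loc = Start nat | Wait nat nat | Gamble nat nat | Dip nat nat | Crash nat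

instance loc :: countable
  by countable_datatype

fun succs :: "loc \<Rightarrow> loc set" where
  "succs (Start n) = (\<lambda>i. Wait n (delay n i)) ` {..level n}"
| "succs (Wait n 0) = Gamble n ` {..level n}"
| "succs (Wait n (Suc p)) = {Wait n p}"
| "succs (Gamble n j) = {Dip n j, Crash n}"
| "succs (Dip n j) = {Start (Suc n)}"
| "succs (Crash n) = {Start (Suc n)}"

fun law :: "loc \<Rightarrow> loc pmf" where
  "law (Start n) = map_pmf (\<lambda>i. Wait n (delay n i)) (delay_pmf (level n))"
| "law (Wait n p) = return_pmf (Wait n (p - 1))"
| "law (Gamble n j) =
     map_pmf (\<lambda>b. if b then Crash n else Dip n j) (bernoulli_pmf (ratio (level n) ^ Suc j))"
| "law (Dip n j) = return_pmf (Start (Suc n))"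
| "law (Crash n) = return_pmf (Start (Suc n))"

text \<open>The total reward at a location is minus its debt.\<close>

fun debt :: "loc \<Rightarrow> nat" where
  "debt (Dip n j) = depth n j"
| "debt (Crash n) = depth n (Suc (level n))"
| "debt _ = 0"

fun gadget :: "loc \<Rightarrow> nat" where
  "gadget (Start n) = n"
| "gadget (Wait n p) = n"
| "gadget (Gamble n j) = n"
| "gadget (Dip n j) = n"
| "gadget (Crash n) = n"

text \<open>Strictly increasing along transitions, which gives acyclicity, and bounded within each
  gadget, which forces runs to progress. Values are integers because the countdown \<open>p\<close>
  of a \<open>Wait\<close> location is not bounded by the longest delay.\<close>

fun rank :: "loc \<Rightarrow> int" where
  "rank (Start n) = int (arrival n)"
| "rank (Wait n p) = int (arrival n) + 1 + int (delay n (level n)) - int p"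
| "rank (Gamble n j) = int (arrival n) + 2 + int (delay n (level n))"
| "rank (Dip n j) = int (arrival n) + 3 + int (delay n (level n))"
| "rank (Crash n) = int (arrival n) + 3 + int (delay n (level n))"

text \<open>Rewards are differences of the potential \<open>debt\<close>, so path rewards telescope
  and depend only on the end points. Every number is a state; one outside the range of
  \<open>to_nat\<close> behaves like the location that \<open>from_nat\<close> gives it.\<close>

definition game :: "nat mdp" where
  "game = \<lparr>states = UNIV,
     controlled = {x. \<exists>n. from_nat x = Wait n 0},
     transitions = {(x, y). y \<in> to_nat ` succs (from_nat x)},
     prob = (\<lambda>x. map_pmf to_nat (law (from_nat x))),
     rew = (\<lambda>(x, y). real (debt (from_nat x)) - real (debt (from_nat y)))\<rparr>"

abbreviation init :: nat where
  "init \<equiv> to_nat (Start 0)"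

lemma states_game [simp]: "states game = UNIV"
  and controlled_game: "x \<in> controlled game \<longleftrightarrow> (\<exists>n. from_nat x = Wait n 0)"
  and transitions_game: "(x, y) \<in> transitions game \<longleftrightarrow> y \<in> to_nat ` succs (from_nat x)"
  and prob_game: "prob game x = map_pmf to_nat (law (from_nat x))"
  and rew_game: "rew game (x, y) = real (debt (from_nat x)) - real (debt (from_nat y))"
  by (simp_all add: game_def)

lemma successors_game: "successors game x = to_nat ` succs (from_nat x)"
  by (auto simp: transitions_game)

lemma succs_nonempty: "succs l \<noteq> {}"
  by (induction l rule: succs.induct) auto

lemma finite_succs: "finite (succs l)"
  by (induction l rule: succs.induct) auto

lemma set_law: "(\<nexists>n. l = Wait n 0) \<Longrightarrow> set_pmf (law l) \<subseteq> succs l"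
  by (induction l rule: succs.induct) (auto simp: set_delay_pmf)

lemma is_mdp_game: "is_mdp game"
proof -
  have "set_pmf (prob game x) \<subseteq> successors game x" if "x \<notin> controlled game" for x
  proof -
    have "set_pmf (law (from_nat x)) \<subseteq> succs (from_nat x)"
      using that unfolding controlled_game by (rule set_law)
    then show ?thesis
      unfolding successors_game prob_game set_map_pmf by (rule image_mono)
  qed
  then show ?thesis
    unfolding is_mdp_def successors_game by (simp add: succs_nonempty)
qed

lemma finitely_branching_game: "finitely_branching game"
  by (simp add: finitely_branching_def successors_game finite_succs)

lemma rank_less: "l' \<in> succs l \<Longrightarrow> rank l < rank l'"
proof (induction l rule: succs.induct)
  case (1 n)
  then obtain i where "l' = Wait n (delay n i)" "i \<le> level n" by auto
  moreover from this have "delay n i \<le> delay n (level n)"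
    by (simp only: delay_mono)
  ultimately show ?case by simp
qed (auto simp: arrival_Suc simp del: arrival.simps(2))

lemma gadget_le: "l' \<in> succs l \<Longrightarrow> gadget l' \<le> Suc (gadget l)"
  by (induction l rule: succs.induct) auto

lemma acyclic_game: "acyclic (transitions game)"
proof -
  have "rank (from_nat x) < rank (from_nat y)" if "(x, y) \<in> (transitions game)\<^sup>+" for x y
    using that
    by (induction rule: trancl_induct) (auto simp: transitions_game dest!: rank_less)
  then show ?thesis by (auto simp: acyclic_def)
qed

lemma rew_game_Ints: "rew game e \<in> \<int>"
  by (cases e) (simp add: rew_game)

lemma sum_rew_game:
  "(\<Sum>j<n. rew game (f j, f (Suc j))) = real (debt (from_nat (f 0))) - real (debt (from_nat (f n)))"
  using sum_lessThan_telescope'[of "\<lambda>j. real (debt (from_nat (f j)))" n] by (simp add: rew_game)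

lemma reward_implicit_game: "reward_implicit game s"
proof -
  have "path_reward game w = real (debt (from_nat (hd w))) - real (debt (from_nat (last w)))"
    if "w \<noteq> []" for w
    using that unfolding path_reward_def sum_rew_game by (simp add: hd_conv_nth last_conv_nth)
  then show ?thesis
    by (auto simp: reward_implicit_def partial_run_def)
qed

lemma runs_game_steps:
  assumes "\<rho> \<in> runs game s"
  shows "from_nat (\<rho> (Suc i)) \<in> succs (from_nat (\<rho> i))"
proof -
  have "\<rho> (Suc i) \<in> to_nat ` succs (from_nat (\<rho> i))"
    using assms by (simp add: runs_def transitions_game)
  then show ?thesis by auto
qed

lemma runs_game_rank_mono:
  assumes "\<rho> \<in> runs game s"
  shows "strict_mono (\<lambda>i. rank (from_nat (\<rho> i)))"
  by (intro strict_monoI_Suc rank_less runs_game_steps[OF assms])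

lemma runs_game_gadget_le:
  assumes "\<rho> \<in> runs game init"
  shows "gadget (from_nat (\<rho> i)) \<le> i"
proof (induction i)
  case (Suc i)
  with gadget_le[OF runs_game_steps[OF assms, of i]] show ?case by simp
qed (use assms in \<open>simp add: runs_def\<close>)

section \<open>The mirror strategy and its crash probability\<close>

text \<open>The player answers by the deepest dip that the time \<open>t\<close> permits, which need not be the
  current delay index but is never smaller.\<close>

definition guess :: "nat \<Rightarrow> nat \<Rightarrow> nat" where
  "guess n t = Max {j. j \<le> level n \<and> delay n j < t}"

lemma guess_ge: "i \<le> level n \<Longrightarrow> delay n i < t \<Longrightarrow> i \<le> guess n t"
  unfolding guess_def by (rule Max_ge) auto

lemma guess_le: "0 < t \<Longrightarrow> guess n t \<le> level n"
  and delay_guess_less: "0 < t \<Longrightarrow> delay n (guess n t) < t"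
proof -
  assume "0 < t"
  then have "guess n t \<in> {j. j \<le> level n \<and> delay n j < t}"
    unfolding guess_def by (intro Max_in) (auto intro: exI[of _ 0])
  then show "guess n t \<le> level n" "delay n (guess n t) < t" by auto
qed

text \<open>The history serves as a clock: its length is the elapsed time plus one. Hence the strict
  bound \<open>delay n j < t\<close> in \<open>guess\<close> says that the elapsed time is at least
  \<open>delay n j\<close>.\<close>

definition mirror :: "nat list \<Rightarrow> nat pmf" where
  "mirror w = return_pmf (to_nat (Gamble (gadget (from_nat (last w)))
     (guess (gadget (from_nat (last w))) (length w))))"

lemma mirror_HD: "HD_strategy game mirror"
  unfolding HD_strategy_def strategy_def mirror_def
  by (auto simp: controlled_game transitions_game partial_run_def intro!: imageI guess_le)

lemma next_state_mirror:
  "next_state game mirror w = map_pmf to_nat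
     (case from_nat (last w) of Wait n 0 \<Rightarrow> return_pmf (Gamble n (guess n (length w))) | l \<Rightarrow> law l)"
  by (auto simp: next_state_def controlled_game prob_game mirror_def split: loc.split nat.split)

text \<open>A bound on the probability of a future \<open>Crash n\<close> from a history of length \<open>t\<close>; it is a
  supermartingale under the mirror strategy.\<close>

fun crash_prob :: "nat \<Rightarrow> nat \<Rightarrow> loc \<Rightarrow> real" where
  "crash_prob n t (Start m) = (if m \<le> n then fail_bound (level n) else 0)"
| "crash_prob n t (Wait m p) =
     (if m < n then fail_bound (level n)
      else if m = n then ratio (level n) ^ Suc (guess n (t + p)) else 0)"
| "crash_prob n t (Gamble m j) =
     (if m < n then fail_bound (level n) else if m = n then ratio (level n) ^ Suc j else 0)"
| "crash_prob n t (Dip m j) = (if m < n then fail_bound (level n) else 0)"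
| "crash_prob n t (Crash m) = (if m < n then fail_bound (level n) else if m = n then 1 else 0)"

text \<open>Delay \<open>i\<close> has probability at most \<open>ratio ^ (K - i)\<close> and is
  answered by at least \<open>i\<close>, so each of the \<open>K + 1\<close> delays contributes at
  most \<open>ratio ^ (K + 1)\<close>.\<close>

lemma crash_prob_start:
  "(\<integral>\<^sup>+i. ennreal (ratio (level n) ^ Suc (guess n (Suc t + delay n i))) \<partial>delay_pmf (level n)) \<le>
   ennreal (fail_bound (level n))"
proof -
  let ?K = "level n"
  let ?r = "ratio ?K"
  have "(\<integral>\<^sup>+i. ennreal (?r ^ Suc (guess n (Suc t + delay n i))) \<partial>delay_pmf ?K) =
      (\<Sum>i\<le>?K. ennreal (?r ^ Suc (guess n (Suc t + delay n i))) * ennreal (pmf (delay_pmf ?K) i))"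
    by (subst nn_integral_measure_pmf_finite) (auto simp: set_delay_pmf)
  also have "\<dots> = (\<Sum>i\<le>?K. ennreal (?r ^ Suc (guess n (Suc t + delay n i)) * pmf (delay_pmf ?K) i))"
    using ratio_pos[of ?K] by (intro sum.cong refl) (simp add: ennreal_mult'')
  also have "\<dots> \<le> (\<Sum>i\<le>?K. ennreal (?r ^ Suc ?K))"
  proof (intro sum_mono ennreal_leI)
    fix i assume i: "i \<in> {..?K}"
    have "?r ^ Suc (guess n (Suc t + delay n i)) * pmf (delay_pmf ?K) i \<le> ?r ^ Suc i * ?r ^ (?K - i)"
      using i ratio_pos[of ?K] ratio_le_1[of ?K]
      by (intro mult_mono pmf_delay_le power_decreasing) (auto intro!: guess_ge)
    also have "\<dots> = ?r ^ Suc ?K"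
      using i by (simp add: power_add[symmetric])
    finally show "?r ^ Suc (guess n (Suc t + delay n i)) * pmf (delay_pmf ?K) i \<le> ?r ^ Suc ?K" .
  qed
  also have "\<dots> = ennreal (fail_bound ?K)"
    using ratio_pos[of ?K] by (subst sum_ennreal) (auto simp: fail_bound_def)
  finally show ?thesis .
qed

text \<open>While waiting, \<open>t + p\<close> stays constant, so the coming answer
  \<open>guess n (t + p)\<close> is already known. Averaging happens at \<open>Start n\<close>, by
  \<open>crash_prob_start\<close>, and at \<open>Gamble n j\<close>, whose value is exactly the
  probability of the crash.\<close>

lemma crash_prob_step:
  assumes "from_nat (last w) \<noteq> Crash n"
  shows "(\<integral>\<^sup>+x. ennreal (crash_prob n (Suc (length w)) (from_nat x)) \<partial>next_state game mirror w) \<le>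
    ennreal (crash_prob n (length w) (from_nat (last w)))"
proof (cases "from_nat (last w) :: loc")
  case (Start m)
  show ?thesis
  proof (cases "m = n")
    case True
    with Start crash_prob_start[of n "length w"] show ?thesis
      by (simp add: next_state_mirror)
  qed (use Start in \<open>auto simp: next_state_mirror\<close>)
next
  case (Wait m p)
  then show ?thesis by (cases p) (auto simp: next_state_mirror)
next
  case (Gamble m j)
  have "crash_prob n t (if b then Crash m else Dip m j) =
      (if m < n then fail_bound (level n) else if m = n \<and> b then 1 else 0)" for t b
    by simp
  with Gamble show ?thesis
    using ratio_pos[of "level n"] ratio_le_1[of "level n"]
    by (cases "m = n") (simp_all add: next_state_mirror power_le_one mult_le_one)
next
  case (Dip m j)
  then show ?thesis by (auto simp: next_state_mirror)
next
  case (Crash m)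
  with assms show ?thesis by (auto simp: next_state_mirror)
qed

lemma hist_mirror_crash:
  "emeasure (hist (next_state game mirror) [init] t) {w. Crash n \<in> from_nat ` set w} \<le>
   ennreal (fail_bound (level n))"
proof -
  let ?K = "next_state game mirror"
  \<comment> \<open>\<open>crash_prob n\<close> drops to 0 once gadget \<open>n\<close> is left, so
    \<open>V\<close> is frozen at 1 from the crash on in order to dominate the indicator.\<close>
  define V where "V w = (if Crash n \<in> from_nat ` set w then 1
    else ennreal (crash_prob n (length w) (from_nat (last w))))" for w
  have "emeasure (hist ?K [init] t) {w. Crash n \<in> from_nat ` set w} =
      (\<integral>\<^sup>+w. indicator {w. Crash n \<in> from_nat ` set w} w \<partial>hist ?K [init] t)"
    by simp
  also have "\<dots> \<le> (\<integral>\<^sup>+w. V w \<partial>hist ?K [init] t)"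
    by (intro nn_integral_mono) (simp add: V_def indicator_def)
  also have "\<dots> \<le> V [init]"
  proof (rule hist_supermartingale)
    fix w :: "nat list" assume "w \<noteq> []"
    show "(\<integral>\<^sup>+x. V (w @ [x]) \<partial>?K w) \<le> V w"
    proof (cases "Crash n \<in> from_nat ` set w")
      case True
      then have "V (w @ [x]) = 1" "V w = 1" for x by (auto simp: V_def)
      then show ?thesis by simp
    next
      case False
      then have "from_nat (last w) \<noteq> Crash n"
        using last_in_set[OF \<open>w \<noteq> []\<close>] by (auto simp: image_iff)
      moreover have "V (w @ [x]) = ennreal (crash_prob n (Suc (length w)) (from_nat x))" for x
        using False by (cases "from_nat x = Crash n") (auto simp: V_def)
      ultimately show ?thesis
        using False crash_prob_step[of w n] by (simp add: V_def)
    qed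
  qed simp
  also have "\<dots> \<le> ennreal (fail_bound (level n))"
    by (simp add: V_def)
  finally show ?thesis .
qed

lemma mirror_crash:
  "{\<rho>. \<exists>t. from_nat (\<rho> t) = Crash n} \<in> sets (run_measure game init mirror)"
  "emeasure (run_measure game init mirror) {\<rho>. \<exists>t. from_nat (\<rho> t) = Crash n} \<le>
   ennreal (fail_bound (level n))"
proof -
  let ?R = "run_measure game init mirror"
  let ?A = "\<lambda>t. {\<rho>. Crash n \<in> from_nat ` set (map \<rho> [0..<Suc t])}"
  have img: "from_nat ` set (map \<rho> [0..<Suc t]) = (\<lambda>i. from_nat (\<rho> i) :: loc) ` {..t}" for \<rho> t
    by (simp add: image_image atLeast0LessThan lessThan_Suc_atMost del: upt_Suc)
  have U: "{\<rho>. \<exists>t. from_nat (\<rho> t) = Crash n} = (\<Union>t. ?A t)"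
    unfolding img by (auto simp: image_iff) (metis atMost_iff order_refl)
  have A: "range ?A \<subseteq> sets ?R"
    using sets_run_prefix[where P="\<lambda>w. Crash n \<in> from_nat ` set w"] by blast
  then show "{\<rho>. \<exists>t. from_nat (\<rho> t) = Crash n} \<in> sets ?R"
    unfolding U by auto
  have "incseq ?A"
    unfolding img by (auto simp: incseq_def)
  then have "emeasure ?R (\<Union>t. ?A t) = (SUP t. emeasure ?R (?A t))"
    using A by (simp only: SUP_emeasure_incseq)
  also have "\<dots> \<le> ennreal (fail_bound (level n))"
    using hist_mirror_crash
    by (intro SUP_least) (simp only: emeasure_run_prefix[where P="\<lambda>w. Crash n \<in> from_nat ` set w"])
  finally show "emeasure ?R {\<rho>. \<exists>t. from_nat (\<rho> t) = Crash n} \<le> ennreal (fail_bound (level n))"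
    unfolding U .
qed

section \<open>Almost sure success of the mirror strategy\<close>

lemma AE_mirror_finite_crashes:
  "AE \<rho> in run_measure game init mirror. finite {n. \<exists>t. from_nat (\<rho> t) = Crash n}"
proof -
  let ?R = "run_measure game init mirror"
  interpret prob_space ?R by (rule prob_space_run_measure)
  let ?A = "\<lambda>n. {\<rho>. \<exists>t. from_nat (\<rho> t) = Crash n}"
  have le: "measure ?R (?A n) \<le> fail_bound (level n)" for n
    using mirror_crash(2)[of n] fail_bound_nonneg by (simp add: emeasure_eq_measure)
  have "AE \<rho> in ?R. eventually (\<lambda>n. \<rho> \<in> space ?R - ?A n) sequentially"
  proof (rule borel_cantelli_AE1)
    show "summable (\<lambda>n. measure ?R (?A n))"
      by (rule summable_comparison_test'[OF summable_fail_bound]) (simp add: le)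
  qed (auto simp: mirror_crash(1) less_top[symmetric])
  then show ?thesis
  proof eventually_elim
    case (elim \<rho>)
    then obtain N where "\<forall>n\<ge>N. \<rho> \<notin> ?A n"
      by (auto simp: eventually_sequentially)
    then have "{n. \<exists>t. from_nat (\<rho> t) = Crash n} \<subseteq> {..<N}"
      by (auto simp: not_le[symmetric])
    then show ?case by (rule finite_subset) simp
  qed
qed

text \<open>A dip inherits its index from the preceding \<open>Gamble\<close>, so the bound on the
  guess is carried along by induction. It says that a dip to \<open>depth n j\<close> comes late
  enough to be cheap.\<close>

lemma mirror_dip_bound:
  assumes "\<rho> 0 = init" "\<And>i. \<rho> (Suc i) \<in> set_pmf (next_state game mirror (map \<rho> [0..<Suc i]))"
  shows "case from_nat (\<rho> i) of
      Gamble n j \<Rightarrow> delay n j \<le> i | Dip n j \<Rightarrow> delay n j \<le> i | _ \<Rightarrow> True"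
proof (induction i)
  case 0
  then show ?case using assms(1) by simp
next
  case (Suc i)
  have last: "last (map \<rho> [0..<Suc i]) = \<rho> i" "length (map \<rho> [0..<Suc i]) = Suc i"
    by simp_all
  obtain l where l: "\<rho> (Suc i) = to_nat l" "l \<in> set_pmf (case from_nat (\<rho> i) of
      Wait n 0 \<Rightarrow> return_pmf (Gamble n (guess n (Suc i))) | l \<Rightarrow> law l)"
    using assms(2)[of i] unfolding next_state_mirror last by auto
  have "delay n (guess n (Suc i)) \<le> Suc i" for n
    using delay_guess_less[of "Suc i" n] by simp
  with l Suc show ?case
    by (auto split: loc.splits nat.splits if_splits)
qed

text \<open>The rank grows by at least 1 per step, while locations of gadgets up to \<open>n\<close>
  have rank at most \<open>arrival (Suc n)\<close>.\<close>

lemma runs_game_gadget_unbounded: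
  assumes "\<rho> \<in> runs game s"
  shows "finite {p. gadget (from_nat (\<rho> p)) \<le> n}"
proof -
  have rank_le: "rank l \<le> int (arrival (Suc n))" if "gadget l \<le> n" for l
  proof -
    have le: "arrival (Suc (gadget l)) \<le> arrival (Suc n)"
      using that by (intro monoD[OF mono_arrival]) simp
    have "rank l \<le> int (arrival (Suc (gadget l)))"
      by (cases l) (auto simp: arrival_Suc simp del: arrival.simps)
    also have "\<dots> \<le> int (arrival (Suc n))"
      using le by (simp only: of_nat_le_iff)
    finally show ?thesis .
  qed
  have rank_ge: "rank (from_nat (\<rho> 0)) + int p \<le> rank (from_nat (\<rho> p))" for p
  proof (induction p)
    case (Suc p)
    with strict_monoD[OF runs_game_rank_mono[OF assms], of p "Suc p"] show ?case by simp
  qed simp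
  have "p \<le> nat (int (arrival (Suc n)) - rank (from_nat (\<rho> 0)))"
    if "gadget (from_nat (\<rho> p)) \<le> n" for p
    using rank_le[OF that] rank_ge[of p] by simp
  then have "{p. gadget (from_nat (\<rho> p)) \<le> n} \<subseteq> {..nat (int (arrival (Suc n)) - rank (from_nat (\<rho> 0)))}"
    by auto
  then show ?thesis by (rule finite_subset) simp
qed

text \<open>The average reward at time \<open>p\<close> is minus the debt divided by
  \<open>p\<close>. Crashes stop eventually, dips in gadget \<open>n\<close> cost at most
  \<open>1 / Suc n\<close>, and the gadget number tends to infinity.\<close>

lemma mirror_wins: "measure (run_measure game init mirror) (MP_liminf_nonneg game init) = 1"
proof -
  let ?R = "run_measure game init mirror"
  interpret prob_space ?R by (rule prob_space_run_measure)
  have "AE \<rho> in ?R. \<rho> \<in> MP_liminf_nonneg game init"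
    using AE_run_measure_steps[where M=game and s\<^sub>0=init and \<sigma>=mirror] AE_mirror_finite_crashes
  proof eventually_elim
    case (elim \<rho>)
    have init: "\<rho> 0 = init"
      and step: "\<And>i. \<rho> (Suc i) \<in> set_pmf (next_state game mirror (map \<rho> [0..<Suc i]))"
      using elim by auto
    have "set_pmf (next_state game mirror w) \<subseteq> successors game (last w)" if "w \<noteq> []" for w
      using that guess_le[of "length w"] unfolding next_state_mirror successors_game
      by (auto simp: set_delay_pmf split: loc.splits nat.splits)
    from this[of "map \<rho> [0..<Suc i]" for i] have run: "\<rho> \<in> runs game init"
      using init step by (fastforce simp: runs_def)
    obtain N where N: "\<And>n t. from_nat (\<rho> t) = Crash n \<Longrightarrow> n \<le> N"
      using elim(2) by (auto simp: finite_nat_set_iff_bounded_le)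
    have "(0 :: ereal) \<le> liminf (\<lambda>n. ereal (1 / real n * (\<Sum>j<n. rew game (\<rho> j, \<rho> (Suc j)))))"
      unfolding le_Liminf_iff
    proof (intro allI impI)
      fix y :: ereal assume "y < 0"
      then obtain e where e: "y < ereal e" "e < 0"
        using ereal_dense2[of y 0] by (auto simp: zero_ereal_def)
      obtain k where k: "1 / real (Suc k) < - e"
        using e(2) nat_approx_posE[of "- e"] by auto
      have "eventually (\<lambda>p. \<not> gadget (from_nat (\<rho> p)) \<le> max N k) sequentially"
        using runs_game_gadget_unbounded[OF run, of "max N k"]
        by (simp add: cofinite_eq_sequentially[symmetric] eventually_cofinite)
      with eventually_gt_at_top[of 0]
      show "eventually (\<lambda>p. y < ereal (1 / real p * (\<Sum>j<p. rew game (\<rho> j, \<rho> (Suc j))))) sequentially"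
      proof eventually_elim
        case (elim p)
        \<comment> \<open>Beyond gadget \<open>max N k\<close> no crash is left, and a dip in gadget
          \<open>n\<close> with \<open>k < n\<close> satisfies
          \<open>depth n j * Suc k \<le> delay n j \<le> p\<close>.\<close>
        have "real (debt (from_nat (\<rho> p))) * real (Suc k) \<le> real p"
        proof (cases "from_nat (\<rho> p) :: loc")
          case (Dip n j)
          then have "debt (from_nat (\<rho> p)) * Suc k \<le> delay n j"
            using elim by (auto simp: delay_def)
          also have "\<dots> \<le> p"
            using mirror_dip_bound[OF init step, of p] Dip by simp
          finally show ?thesis by (simp only: of_nat_mult[symmetric] of_nat_le_iff)
        next
          case (Crash n)
          with N[OF this] elim show ?thesis by simp
        qed auto
        then have "real (debt (from_nat (\<rho> p))) / real p \<le> 1 / real (Suc k)"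
          using elim by (simp add: field_simps)
        with k have "e < 1 / real p * (\<Sum>j<p. rew game (\<rho> j, \<rho> (Suc j)))"
          unfolding sum_rew_game init by simp
        with e(1) show ?case using less_trans[of y "ereal e"] by simp
      qed
    qed
    with run show ?case by (simp add: MP_liminf_nonneg_def)
  qed
  then show ?thesis
    by (subst prob_eq_1) auto
qed

section \<open>Finite memory\<close>

text \<open>At such a position \<open>p\<close> of a run from \<open>init\<close> the average reward
  is at most -1.\<close>

definition bad :: "nat \<Rightarrow> nat list \<Rightarrow> bool" where
  "bad n w \<longleftrightarrow> (\<exists>p<length w. 0 < p \<and> gadget (from_nat (w ! p)) = n \<and> p \<le> debt (from_nat (w ! p)))"

lemma bad_append: "bad n w \<Longrightarrow> bad n (w @ u)"
  unfolding bad_def by (metis length_append nth_append trans_less_add1)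

lemma bad_snoc: "w \<noteq> [] \<Longrightarrow> gadget (from_nat x) = n \<Longrightarrow> length w \<le> debt (from_nat x) \<Longrightarrow> bad n (w @ [x])"
  unfolding bad_def by (intro exI[of _ "length w"]) auto

lemma hist_bad:
  assumes "bad n (map snd h)" "w \<in> set_pmf (hist K h t)"
  shows "bad n (map snd w)"
  using hist_extends[OF assms(2)] bad_append[OF assms(1)] by (metis map_append)

lemma pmf_pigeonhole:
  assumes "finite I" "I \<noteq> {}" "c \<le> measure (measure_pmf p) (\<Union>i\<in>I. X i)"
  obtains i where "i \<in> I" "c / real (card I) \<le> measure (measure_pmf p) (X i)"
proof -
  have "\<exists>i\<in>I. c / real (card I) \<le> measure (measure_pmf p) (X i)"
  proof (rule ccontr)
    assume "\<not> ?thesis"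
    then have "(\<Sum>i\<in>I. measure (measure_pmf p) (X i)) < (\<Sum>i\<in>I. c / real (card I))"
      using assms by (intro sum_strict_mono) auto
    also have "\<dots> = c"
      using assms by simp
    also have "c \<le> (\<Sum>i\<in>I. measure (measure_pmf p) (X i))"
      using assms(3) measure_pmf.finite_measure_subadditive_finite[of I X p] assms(1) by auto
    finally show False by simp
  qed
  with that show thesis by blast
qed

section \<open>Passage of a finite-memory player through one gadget\<close>

locale finite_memory =
  fixes Q :: "nat set" and \<tau> :: "nat \<Rightarrow> nat \<Rightarrow> (nat \<times> nat) pmf"
  assumes finite_modes: "finite Q" and memory: "memory_structure game Q \<tau>"
begin

definition step :: "(nat \<times> nat) list \<Rightarrow> (nat \<times> nat) pmf" where
  "step h = \<tau> (fst (last h)) (snd (last h))"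

lemma step_support:
  assumes "last h = (q, to_nat l)" "q \<in> Q" "x \<in> set_pmf (step h)"
  shows "\<exists>q'\<in>Q. \<exists>l'\<in>succs l. x = (q', to_nat l')"
proof -
  have "set_pmf (\<tau> q (to_nat l)) \<subseteq> Q \<times> successors game (to_nat l)"
    using memory assms(2) unfolding memory_structure_def by simp
  with assms(1,3) have "x \<in> Q \<times> to_nat ` succs l"
    unfolding successors_game by (auto simp: step_def)
  then show ?thesis by auto
qed

lemma measure_step:
  assumes "last h = (q, to_nat l)" "q \<in> Q" "\<nexists>n. l = Wait n 0"
  shows "measure (step h) {x. snd x = to_nat l'} = pmf (law l) l'"
proof -
  have "to_nat l \<notin> controlled game"
    using assms(3) by (simp add: controlled_game)
  then have "map_pmf snd (step h) = map_pmf to_nat (law l)"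
    using memory assms(1,2) unfolding memory_structure_def by (simp add: step_def prob_game)
  then have "pmf (map_pmf snd (step h)) (to_nat l') = pmf (law l) l'"
    by (simp add: pmf_map_inj')
  then show ?thesis
    by (simp add: pmf_map vimage_def)
qed

lemma hist_wait:
  assumes "last h = (q, to_nat (Wait n p))" "q \<in> Q" "w \<in> set_pmf (hist step h p)"
  obtains q' where "q' \<in> Q" "last w = (q', to_nat (Wait n 0))"
proof -
  have "\<exists>q'\<in>Q. last w = (q', to_nat (Wait n 0))"
    using assms
  proof (induction p arbitrary: h q)
    case (Suc p)
    from Suc.prems(3) obtain x where x: "x \<in> set_pmf (step h)" "w \<in> set_pmf (hist step (h @ [x]) p)"
      unfolding hist_Suc_left by auto
    from step_support[OF Suc.prems(1,2) x(1)] obtain q' where "q' \<in> Q" "x = (q', to_nat (Wait n p))"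
      by auto
    with Suc.IH[of "h @ [x]" q'] x(2) show ?case by simp
  qed simp
  with that show thesis by blast
qed

text \<open>A history of length \<open>length h\<close> has made \<open>length h - 1\<close> steps,
  so the last conjunct is the bound \<open>arrival n - 3\<close> on the entry time.\<close>

definition entry :: "nat \<Rightarrow> (nat \<times> nat) list \<Rightarrow> bool" where
  "entry n h \<longleftrightarrow> h \<noteq> [] \<and> fst (last h) \<in> Q \<and> snd (last h) = to_nat (Start n) \<and> length h + 2 \<le> arrival n"

text \<open>The history stopped at the decision \<open>Wait n 0\<close>; the number of steps still
  to wait is read off the location drawn first.\<close>

definition wait :: "(nat \<times> nat) list \<Rightarrow> (nat \<times> nat) list pmf" where
  "wait h = bind_pmf (step h) (\<lambda>x. hist step (h @ [x]) (case from_nat (snd x) of Wait n p \<Rightarrow> p | _ \<Rightarrow> 0))"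

text \<open>The three steps after the decision lead to \<open>Gamble\<close>, to \<open>Dip\<close>
  or \<open>Crash\<close>, and to \<open>Start (Suc n)\<close>.\<close>

definition pass :: "(nat \<times> nat) list \<Rightarrow> (nat \<times> nat) list pmf" where
  "pass h = bind_pmf (wait h) (\<lambda>w. hist step w 3)"

lemma entry_step:
  assumes "entry n h" "x \<in> set_pmf (step h)"
  obtains q i where "q \<in> Q" "i \<le> level n" "x = (q, to_nat (Wait n (delay n i)))"
proof -
  have "last h = (fst (last h), to_nat (Start n))" "fst (last h) \<in> Q"
    using assms(1) by (auto simp: entry_def prod_eq_iff)
  from step_support[OF this assms(2)] that show thesis by auto
qed

lemma wait_support:
  assumes "entry n h" "w \<in> set_pmf (wait h)"
  obtains q i where "q \<in> Q" "i \<le> level n" "last w = (q, to_nat (Wait n 0))"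
    "length w = Suc (length h) + delay n i"
proof -
  from assms(2) obtain x where x: "x \<in> set_pmf (step h)"
      "w \<in> set_pmf (hist step (h @ [x]) (case from_nat (snd x) of Wait n p \<Rightarrow> p | _ \<Rightarrow> 0))"
    by (auto simp: wait_def)
  from entry_step[OF assms(1) x(1)] obtain q i
    where q: "q \<in> Q" "i \<le> level n" "x = (q, to_nat (Wait n (delay n i)))" .
  with x(2) have w: "w \<in> set_pmf (hist step (h @ [x]) (delay n i))" by simp
  have "last (h @ [x]) = (q, to_nat (Wait n (delay n i)))" using q by simp
  from hist_wait[OF this q(1) w] obtain q' where "q' \<in> Q" "last w = (q', to_nat (Wait n 0))" .
  with that q(2) length_hist[OF w] show thesis by simp
qed

lemma hist_decide:
  assumes "last w = (q, to_nat (Wait n 0))" "q \<in> Q" "v \<in> set_pmf (hist step w 3)"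
  obtains q' where "q' \<in> Q" "last v = (q', to_nat (Start (Suc n)))"
proof -
  from assms(3) obtain x y z where x: "x \<in> set_pmf (step w)" and y: "y \<in> set_pmf (step (w @ [x]))"
      and z: "z \<in> set_pmf (step (w @ [x, y]))" and v: "v = w @ [x, y, z]"
    by (auto simp: eval_nat_numeral)
  from step_support[OF assms(1,2) x] obtain q1 j where 1: "q1 \<in> Q" "x = (q1, to_nat (Gamble n j))"
    by auto
  then have "last (w @ [x]) = (q1, to_nat (Gamble n j))" by simp
  from step_support[OF this 1(1) y] obtain q2 l where 2: "q2 \<in> Q" "y = (q2, to_nat l)"
      "l \<in> {Dip n j, Crash n}" by auto
  then have "last (w @ [x, y]) = (q2, to_nat l)" by simp
  from step_support[OF this 2(1) z] 2(3) v that show thesis by auto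
qed

lemma pass_support:
  assumes "entry n h" "v \<in> set_pmf (pass h)"
  shows "entry (Suc n) v" "length v \<le> length h + 4 + delay n (level n)"
proof -
  from assms(2) obtain w where w: "w \<in> set_pmf (wait h)" "v \<in> set_pmf (hist step w 3)"
    by (auto simp: pass_def)
  from wait_support[OF assms(1) w(1)] obtain q i where q: "q \<in> Q" "i \<le> level n"
    "last w = (q, to_nat (Wait n 0))" "length w = Suc (length h) + delay n i" .
  from hist_decide[OF q(3,1) w(2)] obtain q' where q': "q' \<in> Q" "last v = (q', to_nat (Start (Suc n)))" .
  have "delay n i \<le> delay n (level n)"
    using q(2) by (rule delay_mono)
  then show le: "length v \<le> length h + 4 + delay n (level n)"
    using length_hist[OF w(2)] q(4) by simp
  have "v \<noteq> []"
    using length_hist[OF w(2)] by auto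
  then show "entry (Suc n) v"
    using le q' assms(1) unfolding entry_def arrival_Suc by simp
qed

text \<open>The length of a passage through a gadget is random, so the remaining number of steps is
  expressed by the length of the history.\<close>

lemma hist_pass:
  assumes "entry n h" "4 + delay n (level n) \<le> t"
  shows "hist step h t = bind_pmf (pass h) (\<lambda>v. hist step v (t + length h - length v))"
proof -
  obtain t' where t: "t = Suc t'" using assms(2) by (cases t) auto
  have "(case from_nat (snd x) of Wait n p \<Rightarrow> p | _ \<Rightarrow> 0) \<le> t'" if "x \<in> set_pmf (step h)" for x
  proof -
    from entry_step[OF assms(1) that] obtain q i where "i \<le> level n" "x = (q, to_nat (Wait n (delay n i)))" .
    with delay_mono[of i "level n" n] assms(2) t show ?thesis by simp
  qed
  then have "hist step h t = bind_pmf (wait h) (\<lambda>w. hist step w (t + length h - length w))"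
    unfolding t wait_def by (rule hist_Suc_stop)
  also have "\<dots> = bind_pmf (wait h) (\<lambda>w. bind_pmf (hist step w 3) (\<lambda>v. hist step v (t + length h - length v)))"
  proof (intro bind_pmf_cong refl)
    fix w assume "w \<in> set_pmf (wait h)"
    from wait_support[OF assms(1) this] obtain i where "i \<le> level n"
      "length w = Suc (length h) + delay n i" .
    with delay_mono[of i "level n" n] assms(2) have "t + length h - length w = 3 + (t + length h - length w - 3)"
      by simp
    then have "hist step w (t + length h - length w) =
        bind_pmf (hist step w 3) (\<lambda>v. hist step v (t + length h - length w - 3))"
      by (metis hist_add)
    also have "\<dots> = bind_pmf (hist step w 3) (\<lambda>v. hist step v (t + length h - length v))"
      by (intro bind_pmf_cong refl) (auto dest!: length_hist)
    finally show "hist step w (t + length h - length w) =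
        bind_pmf (hist step w 3) (\<lambda>v. hist step v (t + length h - length v))" .
  qed
  finally show ?thesis
    unfolding pass_def bind_assoc_pmf .
qed

lemma measure_wait_ge:
  assumes "entry n h" "i \<le> level n"
  shows "pmf (delay_pmf (level n)) i \<le> measure (wait h) {w. length w = Suc (length h) + delay n i}"
proof -
  let ?X = "{x. snd x = to_nat (Wait n (delay n i))}"
  have "inj (\<lambda>i. Wait n (delay n i))"
    by (simp add: inj_def inj_delay)
  then have "pmf (delay_pmf (level n)) i = pmf (law (Start n)) (Wait n (delay n i))"
    by (simp add: pmf_map_inj'[of "\<lambda>i. Wait n (delay n i)"])
  also have "\<dots> = measure (step h) ?X"
    using assms(1) by (intro measure_step[symmetric, of _ "fst (last h)"]) (auto simp: entry_def prod_eq_iff)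
  also have "\<dots> \<le> measure (step h) ?X * 1" by simp
  also have "\<dots> \<le> measure (wait h) {w. length w = Suc (length h) + delay n i}"
    unfolding wait_def
  proof (rule measure_bind_pmf_ge)
    fix x :: "nat \<times> nat" assume "x \<in> ?X"
    then have "AE w in hist step (h @ [x]) (case from_nat (snd x) of Wait n p \<Rightarrow> p | _ \<Rightarrow> 0).
        w \<in> {w. length w = Suc (length h) + delay n i}"
      by (auto simp: AE_measure_pmf_iff dest!: length_hist)
    then show "1 \<le> measure (hist step (h @ [x]) (case from_nat (snd x) of Wait n p \<Rightarrow> p | _ \<Rightarrow> 0))
        {w. length w = Suc (length h) + delay n i}"
      by (subst (asm) measure_pmf.prob_eq_1[symmetric]) auto
  qed simp
  finally show ?thesis .
qed

lemma obtain_mode: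
  assumes "entry n h" "i \<le> level n"
  obtains q where "q \<in> Q" "pmf (delay_pmf (level n)) i / real (card Q) \<le>
    measure (wait h) {w. length w = Suc (length h) + delay n i \<and> last w = (q, to_nat (Wait n 0))}"
proof -
  let ?X = "\<lambda>q. {w. length w = Suc (length h) + delay n i \<and> last w = (q, to_nat (Wait n 0))}"
  have "pmf (delay_pmf (level n)) i \<le> measure (wait h) {w. length w = Suc (length h) + delay n i}"
    by (rule measure_wait_ge[OF assms])
  also have "\<dots> \<le> measure (wait h) (\<Union>q\<in>Q. ?X q)"
    by (intro measure_pmf.finite_measure_mono_AE)
      (auto simp: AE_measure_pmf_iff elim!: wait_support[OF assms(1)])
  finally have "pmf (delay_pmf (level n)) i \<le> measure (wait h) (\<Union>q\<in>Q. ?X q)" .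
  moreover have "Q \<noteq> {}" using assms(1) by (auto simp: entry_def)
  ultimately show thesis
    using that by (rule_tac pmf_pigeonhole[OF finite_modes]) auto
qed

lemma obtain_choice:
  assumes "q \<in> Q"
  obtains j where "j \<le> level n"
    "1 / real (Suc (level n)) \<le> measure (\<tau> q (to_nat (Wait n 0))) {x. snd x = to_nat (Gamble n j)}"
proof -
  let ?p = "\<tau> q (to_nat (Wait n 0))" and ?X = "\<lambda>j. {x :: nat \<times> nat. snd x = to_nat (Gamble n j)}"
  have "last [(q, to_nat (Wait n 0))] = (q, to_nat (Wait n 0))" by simp
  note supp = step_support[OF this assms]
  have "AE x in ?p. x \<in> (\<Union>j\<in>{..level n}. ?X j)"
    unfolding AE_measure_pmf_iff
  proof
    fix x assume "x \<in> set_pmf ?p"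
    with supp[of x] show "x \<in> (\<Union>j\<in>{..level n}. ?X j)" by (auto simp: step_def)
  qed
  then have "1 \<le> measure ?p (\<Union>j\<in>{..level n}. ?X j)"
    by (subst (asm) measure_pmf.prob_eq_1[symmetric]) auto
  then show thesis
    using that by (rule_tac pmf_pigeonhole[of "{..level n}" 1 ?p ?X]) auto
qed

lemma measure_hist_bad:
  assumes "bad n (map snd h)"
  shows "measure (hist step h t) {v. bad n (map snd v)} = 1"
  by (subst measure_pmf.prob_eq_1) (auto simp: AE_measure_pmf_iff intro: hist_bad[OF assms])

text \<open>The location after the gamble has position \<open>length w + 1\<close>, which is at most
  \<open>depth n (Suc i)\<close>. If \<open>i < j\<close>, dip and crash are both at least that
  deep; otherwise only the crash is counted, of probability
  \<open>ratio (level n) ^ Suc j\<close>.\<close>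

lemma decide_bad:
  assumes w: "last w = (q, to_nat (Wait n 0))" "w \<noteq> []" and q: "q \<in> Q" and i: "i \<le> level n"
    and len: "length w < arrival n + delay n i"
  shows "measure (\<tau> q (to_nat (Wait n 0))) {x. snd x = to_nat (Gamble n j)} *
      (if i < j then 1 else ratio (level n) ^ Suc j) \<le>
    measure (hist step w 3) {v. bad n (map snd v)}" (is "_ * ?c \<le> _")
proof -
  let ?B = "{v. bad n (map snd v)}"
  have c: "0 \<le> ?c" using ratio_pos[of "level n"] by simp
  have len': "length (w @ [x]) \<le> depth n (Suc i)" for x
    using len by (simp add: depth_Suc)
  have gamble: "?c \<le> measure (hist step (w @ [x]) 2) ?B"
    if x: "snd x = to_nat (Gamble n j)" "x \<in> set_pmf (step w)" for x
  proof -
    from step_support[OF w(1) q x(2)] have q': "fst x \<in> Q" by auto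
    have lx: "last (w @ [x]) = (fst x, to_nat (Gamble n j))"
      using x(1) by (simp add: prod_eq_iff)
    let ?Y = "if i < j then UNIV else {y. snd y = to_nat (Crash n)}"
    have bad: "1 \<le> measure (hist step (w @ [x] @ [y]) 1) ?B"
      if y: "y \<in> ?Y" "y \<in> set_pmf (step (w @ [x]))" for y
    proof -
      from step_support[OF lx q' y(2)] obtain l where l: "snd y = to_nat l" "l \<in> {Dip n j, Crash n}"
        by auto
      have "depth n (Suc i) \<le> debt l"
        using l y(1) depth_mono[of "Suc i" j n] depth_mono[of "Suc i" "Suc (level n)" n] i
        by (auto split: if_splits)
      with len'[of x] have "length (w @ [x]) \<le> debt (from_nat (snd y))"
        using l(1) by simp
      then have "bad n (map snd (w @ [x]) @ [snd y])"
        using l by (intro bad_snoc) auto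
      then show ?thesis
        using measure_hist_bad[of n "w @ [x] @ [y]" 1] by simp
    qed
    have "measure (step (w @ [x])) {y. snd y = to_nat (Crash n)} = pmf (law (Gamble n j)) (Crash n)"
      by (rule measure_step[OF lx q']) simp
    also have "\<dots> = ratio (level n) ^ Suc j"
    proof -
      have p: "0 \<le> ratio (level n) ^ Suc j" "ratio (level n) ^ Suc j \<le> 1"
        using ratio_pos[of "level n"] ratio_le_1[of "level n"] by (auto intro!: power_le_one simp del: power_Suc)
      have "inj (\<lambda>b. if b then Crash n else Dip n j)"
        by (auto simp: inj_def)
      from pmf_map_inj'[OF this, of _ True] p show ?thesis by simp
    qed
    finally have "?c = measure (step (w @ [x])) ?Y"
      by simp
    also have "\<dots> = measure (step (w @ [x])) ?Y * 1" by simp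
    also have "\<dots> \<le> measure (hist step (w @ [x]) (Suc 1)) ?B"
      unfolding hist_Suc_left using bad by (intro measure_bind_pmf_ge) auto
    finally show ?thesis by (simp add: numeral_2_eq_2)
  qed
  have "measure (step w) {x. snd x = to_nat (Gamble n j)} * ?c \<le> measure (hist step w (Suc 2)) ?B"
    unfolding hist_Suc_left using gamble c by (intro measure_bind_pmf_ge) auto
  then show ?thesis
    using w(1) by (simp add: step_def eval_nat_numeral)
qed

text \<open>Two delays share a likely mode \<open>q\<close>, and \<open>q\<close> has a likely
  answer \<open>j\<close>, which is bad for one of the two. In \<open>confusion\<close>, one factor
  \<open>1 / Suc K\<close> comes from normalising the delays, the other from choosing
  \<open>j\<close>, and \<open>1 / card Q\<close> from choosing the mode.\<close>

lemma pass_bad: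
  assumes h: "entry n h" and lev: "card Q \<le> level n"
  shows "confusion (card Q) (level n) \<le> measure (pass h) {v. bad n (map snd v)}"
proof -
  let ?K = "level n" and ?B = "{v. bad n (map snd v)}"
  let ?X = "\<lambda>i q. {w. length w = Suc (length h) + delay n i \<and> last w = (q, to_nat (Wait n 0))}"
  let ?m = "real (card Q)" and ?r = "ratio ?K"
  have m: "0 < ?m"
    using h finite_modes by (auto simp: entry_def card_gt_0_iff)
  have r: "0 < ?r" "?r \<le> 1" by (rule ratio_pos ratio_le_1)+
  have "\<exists>q. q \<in> Q \<and> pmf (delay_pmf ?K) i / ?m \<le> measure (wait h) (?X i q)" if "i \<le> ?K" for i
    by (rule obtain_mode[OF h that]) blast
  then have "\<exists>f. \<forall>i. i \<le> ?K \<longrightarrow> f i \<in> Q \<and> pmf (delay_pmf ?K) i / ?m \<le> measure (wait h) (?X i (f i))"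
    by (intro choice) blast
  then obtain f where f: "\<And>i. i \<le> ?K \<Longrightarrow> f i \<in> Q"
      "\<And>i. i \<le> ?K \<Longrightarrow> pmf (delay_pmf ?K) i / ?m \<le> measure (wait h) (?X i (f i))"
    by blast
  \<comment> \<open>There are \<open>?K + 1\<close> delays but at most \<open>?K\<close>
    modes.\<close>
  have "\<not> inj_on f {..?K}"
    using card_inj_on_le[of f "{..?K}" Q] f(1) finite_modes lev by auto
  then obtain i i' where i: "i < i'" "i' \<le> ?K" "f i = f i'"
    unfolding inj_on_def by (metis atMost_iff nat_neq_iff)
  define q where "q = f i"
  have q: "q \<in> Q" using f(1) i by (simp add: q_def)
  obtain j where j: "j \<le> ?K"
      "1 / real (Suc ?K) \<le> measure (\<tau> q (to_nat (Wait n 0))) {x. snd x = to_nat (Gamble n j)}"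
    using obtain_choice[OF q] .
  have pass: "pmf (delay_pmf ?K) l / ?m * (1 / real (Suc ?K) * (if l < j then 1 else ?r ^ Suc j)) \<le>
      measure (pass h) ?B" if l: "l \<le> ?K" "f l = q" for l
  proof -
    let ?c = "measure (\<tau> q (to_nat (Wait n 0))) {x. snd x = to_nat (Gamble n j)} *
      (if l < j then 1 else ?r ^ Suc j)"
    have "pmf (delay_pmf ?K) l / ?m * (1 / real (Suc ?K) * (if l < j then 1 else ?r ^ Suc j)) \<le>
        measure (wait h) (?X l q) * ?c"
      using f(2)[OF l(1)] l(2) j(2) r m by (intro mult_mono) (auto simp: zero_le_divide_iff)
    also have "\<dots> \<le> measure (pass h) ?B"
      unfolding pass_def
    proof (rule measure_bind_pmf_ge)
      fix w assume "w \<in> ?X l q"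
      then show "?c \<le> measure (hist step w 3) ?B"
        using h l(1) q by (intro decide_bad) (auto simp: entry_def)
    qed (use r in auto)
    finally show ?thesis .
  qed
  have conf: "confusion (card Q) ?K = ?r ^ ?K / real (Suc ?K) / ?m * (1 / real (Suc ?K))"
    by (simp add: confusion_def power2_eq_square)
  show ?thesis
  \<comment> \<open>If \<open>i < j\<close>, delay \<open>i\<close> followed by \<open>j\<close> is
    bad whatever chance does. Otherwise \<open>j < i'\<close>, and delay \<open>i'\<close> followed
    by \<open>j\<close> crashes with weight \<open>ratio ^ (K - i' + j + 1)\<close>, whose exponent
    is at most \<open>K\<close>.\<close>
  proof (cases "i < j")
    case True
    have "?r ^ ?K \<le> ?r ^ (?K - i)" using r by (intro power_decreasing) auto
    then have "?r ^ ?K / real (Suc ?K) \<le> pmf (delay_pmf ?K) i"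
      using pmf_delay_ge[of i ?K] i divide_right_mono[of "?r ^ ?K" "?r ^ (?K - i)" "real (Suc ?K)"] by linarith
    then have "confusion (card Q) ?K \<le> pmf (delay_pmf ?K) i / ?m * (1 / real (Suc ?K))"
      unfolding conf using m by (intro mult_right_mono divide_right_mono) auto
    with pass[of i] True i show ?thesis by (simp add: q_def)
  next
    case False
    have "?r ^ ?K \<le> ?r ^ (?K - i' + Suc j)"
      using r False i by (intro power_decreasing) auto
    then have "?r ^ ?K / real (Suc ?K) \<le> ?r ^ (?K - i') / real (Suc ?K) * ?r ^ Suc j"
      by (simp add: power_add divide_right_mono mult_ac)
    also have "\<dots> \<le> pmf (delay_pmf ?K) i' * ?r ^ Suc j"
      using pmf_delay_ge[of i' ?K] i r by (intro mult_right_mono) auto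
    finally have "confusion (card Q) ?K \<le> pmf (delay_pmf ?K) i' * ?r ^ Suc j / ?m * (1 / real (Suc ?K))"
      unfolding conf using m by (intro mult_right_mono divide_right_mono) auto
    with pass[of i'] False i show ?thesis by (simp add: q_def mult_ac)
  qed
qed

section \<open>Survival through many gadgets\<close>

definition factor :: "nat \<Rightarrow> nat \<Rightarrow> real" where
  "factor n\<^sub>0 n = (if n\<^sub>0 \<le> n then 1 - confusion (card Q) (level n) else 1)"

lemma factor_nonneg: "0 \<le> factor n\<^sub>0 n"
  using confusion_le_1 by (simp add: factor_def)

text \<open>Downward induction on \<open>n\<close>, splitting off one passage at a time. The bound
  of \<open>pass_bad\<close> holds for every entry history, so the survival probabilities multiply;
  gadgets below \<open>n\<^sub>0\<close> may have too low a level and count with factor 1. One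
  passage takes at most \<open>arrival (Suc n) - arrival n\<close> steps, so \<open>t\<close> steps
  suffice to reach \<open>n\<^sub>1\<close>.\<close>

lemma hist_survive:
  assumes "n \<le> n\<^sub>1" and lev: "\<And>n. n\<^sub>0 \<le> n \<Longrightarrow> card Q \<le> level n"
    and "entry n h" "arrival n\<^sub>1 - arrival n \<le> t"
  shows "emeasure (hist step h t) {v. \<forall>l. n\<^sub>0 \<le> l \<and> l < n\<^sub>1 \<longrightarrow> \<not> bad l (map snd v)} \<le>
    ennreal (\<Prod>l\<in>{n..<n\<^sub>1}. factor n\<^sub>0 l)"
  using assms(1,3,4)
proof (induction n arbitrary: h t rule: inc_induct)
  case base
  show ?case by (simp add: measure_pmf.emeasure_le_1)
next
  case (step n)
  let ?S = "{v. \<forall>l. n\<^sub>0 \<le> l \<and> l < n\<^sub>1 \<longrightarrow> \<not> bad l (map snd v)}"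
  let ?P = "\<Prod>l\<in>{Suc n..<n\<^sub>1}. factor n\<^sub>0 l"
  let ?G = "{v. n\<^sub>0 \<le> n \<longrightarrow> \<not> bad n (map snd v)}"
  have P: "0 \<le> ?P" by (intro prod_nonneg) (simp add: factor_nonneg)
  have arr: "arrival (Suc n) \<le> arrival n\<^sub>1"
    using step.hyps by (intro monoD[OF mono_arrival]) simp
  have t: "4 + delay n (level n) \<le> t"
    using step.prems(2) arr unfolding arrival_Suc by linarith
  have "emeasure (hist step h t) ?S =
      (\<integral>\<^sup>+v. emeasure (hist step v (t + length h - length v)) ?S \<partial>pass h)"
    unfolding hist_pass[OF step.prems(1) t] by simp
  \<comment> \<open>Outside \<open>?G\<close> gadget \<open>n\<close> is already bad and stays so;
    inside, the induction hypothesis applies to the entry history \<open>v\<close>.\<close>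
  also have "\<dots> \<le> (\<integral>\<^sup>+v. ennreal ?P * indicator ?G v \<partial>pass h)"
  proof (intro nn_integral_mono_AE, unfold AE_measure_pmf_iff, intro ballI)
    fix v assume v: "v \<in> set_pmf (pass h)"
    note pv = pass_support[OF step.prems(1) v]
    show "emeasure (hist step v (t + length h - length v)) ?S \<le> ennreal ?P * indicator ?G v"
    proof (cases "v \<in> ?G")
      case True
      have "arrival n\<^sub>1 - arrival (Suc n) \<le> t + length h - length v"
        using step.prems(2) pv(2) unfolding arrival_Suc by linarith
      from step.IH[OF pv(1) this] True show ?thesis by simp
    next
      case False
      then have "bad n (map snd u)" if "u \<in> set_pmf (hist step v (t + length h - length v))" for u
        using hist_bad[OF _ that] by simp
      then have "AE u in hist step v (t + length h - length v). u \<notin> ?S"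
        using False step.hyps by (auto simp: AE_measure_pmf_iff)
      from emeasure_eq_0_AE[OF this] have "emeasure (hist step v (t + length h - length v)) ?S = 0"
        by simp
      then show ?thesis by simp
    qed
  qed
  also have "\<dots> = ennreal ?P * emeasure (pass h) ?G"
    by (rule nn_integral_cmult_indicator) simp
  also have "\<dots> \<le> ennreal ?P * ennreal (factor n\<^sub>0 n)"
  proof (intro mult_left_mono)
    show "emeasure (pass h) ?G \<le> ennreal (factor n\<^sub>0 n)"
    proof (cases "n\<^sub>0 \<le> n")
      case True
      then have "emeasure (pass h) ?G = emeasure (pass h) (space (pass h) - {v. bad n (map snd v)})"
        by (intro arg_cong2[where f=emeasure]) auto
      also have "\<dots> = ennreal (1 - measure (pass h) {v. bad n (map snd v)})"
        by (simp only: measure_pmf.emeasure_eq_measure measure_pmf.prob_compl sets_measure_pmf UNIV_I)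
      also have "\<dots> \<le> ennreal (factor n\<^sub>0 n)"
        using True pass_bad[OF step.prems(1) lev] by (intro ennreal_leI) (simp add: factor_def)
      finally show ?thesis .
    qed (simp add: factor_def measure_pmf.emeasure_le_1)
  qed simp
  also have "\<dots> = ennreal (\<Prod>l\<in>{n..<n\<^sub>1}. factor n\<^sub>0 l)"
    using P step.hyps factor_nonneg
    by (simp add: ennreal_mult[symmetric] prod.atLeast_Suc_lessThan mult.commute)
  finally show ?case .
qed

end

section \<open>Almost sure failure of finite memory\<close>

lemma MP_eventually_not_bad:
  assumes "\<rho> \<in> MP_liminf_nonneg game init"
  shows "\<exists>N. \<forall>n\<ge>N. \<forall>t. \<not> bad n (map \<rho> [0..<t])"
proof -
  have run: "\<rho> \<in> runs game init"
    and "(-1 :: ereal) < liminf (\<lambda>n. ereal (1 / real n * (\<Sum>j<n. rew game (\<rho> j, \<rho> (Suc j)))))"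
    using assms less_le_trans[of "-1 :: ereal" 0] by (auto simp: MP_liminf_nonneg_def)
  then have "eventually (\<lambda>n. (-1 :: ereal) < ereal (1 / real n * (\<Sum>j<n. rew game (\<rho> j, \<rho> (Suc j))))) sequentially"
    by (simp add: less_LiminfD)
  then obtain N where N: "\<And>p. N \<le> p \<Longrightarrow> (-1 :: ereal) < ereal (1 / real p * (\<Sum>j<p. rew game (\<rho> j, \<rho> (Suc j))))"
    by (auto simp: eventually_sequentially)
  have "\<not> bad n (map \<rho> [0..<t])" if "N \<le> n" for n t
  proof
    assume "bad n (map \<rho> [0..<t])"
    then obtain p where p: "0 < p" "gadget (from_nat (\<rho> p)) = n" "p \<le> debt (from_nat (\<rho> p))"
      by (auto simp: bad_def)
    \<comment> \<open>Reaching gadget \<open>n\<close> takes at least \<open>n\<close> steps, so a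
      bad position in a late gadget is late in time.\<close>
    have "N \<le> p" using runs_game_gadget_le[OF run, of p] p(2) that by simp
    have "1 \<le> real (debt (from_nat (\<rho> p))) / real p"
      using p by simp
    with N[OF \<open>N \<le> p\<close>] show False
      using run unfolding sum_rew_game
      by (simp add: runs_def one_ereal_def)
  qed
  then show ?thesis by blast
qed

text \<open>From level \<open>card Q\<close> on, avoiding bad gadgets through \<open>r\<close>
  blocks has probability at most \<open>exp (- r / card Q)\<close>. The null set is the intersection
  over \<open>r\<close> of events that depend on finite prefixes.\<close>

lemma (in finite_memory) measure_eventually_not_bad:
  assumes law: "\<And>t. hist (next_state game \<sigma>) [init] t = map_pmf (map snd) (memory_chain \<tau> m init t)"
    and m: "m \<in> Q" and K: "card Q \<le> K"
  shows "\<exists>A \<in> null_sets (run_measure game init \<sigma>).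
    {\<rho>. \<forall>n\<ge>block_start K. \<forall>t. \<not> bad n (map \<rho> [0..<t])} \<subseteq> A"
proof -
  let ?R = "run_measure game init \<sigma>"
  interpret R: prob_space ?R by (rule prob_space_run_measure)
  let ?n = "block_start K"
  let ?P = "\<lambda>r w. \<forall>l. ?n \<le> l \<and> l < block_start (K + r) \<longrightarrow> \<not> bad l w"
  let ?A = "\<lambda>r. {\<rho>. ?P r (map \<rho> [0..<Suc (arrival (block_start (K + r)))])}"
  have meas: "?A r \<in> sets ?R" for r
    by (rule sets_run_prefix[where P="?P r"])
  have le: "emeasure ?R (?A r) \<le> ennreal (exp (- (real r / real (card Q))))" for r
  proof -
    let ?n1 = "block_start (K + r)"
    have n1: "?n \<le> ?n1" by (intro monoD[OF mono_block_start]) simp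
    have "emeasure ?R (?A r) = emeasure (hist (next_state game \<sigma>) [init] (arrival ?n1)) {w. ?P r w}"
      by (rule emeasure_run_prefix)
    also have "\<dots> = emeasure (hist step [(m, init)] (arrival ?n1)) {h. ?P r (map snd h)}"
      unfolding law memory_chain_eq_hist by (simp add: step_def[abs_def] vimage_def)
    also have "\<dots> \<le> ennreal (\<Prod>l\<in>{0..<?n1}. factor ?n l)"
    proof (rule hist_survive)
      show "card Q \<le> level n" if "?n \<le> n" for n
        using K level_ge[OF that] by simp
      show "entry 0 [(m, init)]"
        using m by (simp add: entry_def)
    qed auto
    also have "(\<Prod>l\<in>{0..<?n1}. factor ?n l) = (\<Prod>l\<in>{?n..<?n1}. factor ?n l)"
      using n1 by (intro prod.mono_neutral_right) (auto simp: factor_def)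
    also have "\<dots> = (\<Prod>l\<in>{?n..<?n1}. 1 - confusion (card Q) (level l))"
      by (intro prod.cong) (auto simp: factor_def)
    also have "ennreal \<dots> \<le> ennreal (exp (- (real r / real (card Q))))"
      by (intro ennreal_leI prod_confusion_le)
    finally show ?thesis .
  qed
  let ?B = "\<Inter>r. ?A r"
  have B: "?B \<in> sets ?R" using meas by (intro sets.countable_INT) auto
  have "measure ?R ?B \<le> exp (- (1 / real (card Q))) ^ r" for r
  proof -
    have "emeasure ?R ?B \<le> emeasure ?R (?A r)"
      by (rule emeasure_mono[OF _ meas]) blast
    also note le
    finally have "measure ?R ?B \<le> exp (- (real r / real (card Q)))"
      by (simp add: R.emeasure_eq_measure)
    also have "\<dots> = exp (- (1 / real (card Q))) ^ r"
      by (simp add: exp_of_nat_mult[symmetric])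
    finally show ?thesis .
  qed
  moreover have "0 < card Q" using m finite_modes by (auto simp: card_gt_0_iff)
  moreover have "exp (- (1 / real (card Q))) < 1"
    using \<open>0 < card Q\<close> by simp
  \<comment> \<open>A positive measure would exceed some power of a number below 1.\<close>
  ultimately have "\<not> 0 < measure ?R ?B"
    using real_arch_pow_inv[of "measure ?R ?B" "exp (- (1 / real (card Q)))"]
    by (simp only: not_less[symmetric]) blast
  then have "measure ?R ?B = 0" using measure_nonneg[of ?R ?B] by linarith
  then have "?B \<in> null_sets ?R"
    using B by (auto simp: null_sets_def R.emeasure_eq_measure)
  moreover have "{\<rho>. \<forall>n\<ge>?n. \<forall>t. \<not> bad n (map \<rho> [0..<t])} \<subseteq> ?B"
    by (auto simp del: upt_Suc)
  ultimately show ?thesis by blast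
qed

lemma FR_loses:
  assumes "FR_strategy game \<sigma>"
  shows "measure (run_measure game init \<sigma>) (MP_liminf_nonneg game init) = 0"
proof -
  let ?R = "run_measure game init \<sigma>"
  obtain Q :: "nat set" and \<tau> m where Q: "finite Q" "m \<in> Q" "memory_structure game Q \<tau>"
    and ind: "\<forall>w. partial_run game w \<and> last w \<in> controlled game \<and> memory_compatible \<tau> m w \<longrightarrow>
      \<sigma> w = induced_strategy \<tau> m w"
    using assms unfolding FR_strategy_def by blast
  interpret finite_memory Q \<tau>
    using Q by unfold_locales
  have law: "hist (next_state game \<sigma>) [init] t = map_pmf (map snd) (memory_chain \<tau> m init t)" for t
    using ind by (intro FR_law[OF is_mdp_game Q(3,2)]) auto
  \<comment> \<open>The shift by \<open>card Q\<close> starts the count at a level where the number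
    of delays exceeds the number of modes.\<close>
  have "\<exists>A. \<forall>K. A K \<in> null_sets ?R \<and>
      {\<rho>. \<forall>n\<ge>block_start (card Q + K). \<forall>t. \<not> bad n (map \<rho> [0..<t])} \<subseteq> A K"
    using measure_eventually_not_bad[OF law Q(2)] by (intro choice) (meson le_add1)
  then obtain A where A: "\<And>K. A K \<in> null_sets ?R"
      "\<And>K. {\<rho>. \<forall>n\<ge>block_start (card Q + K). \<forall>t. \<not> bad n (map \<rho> [0..<t])} \<subseteq> A K"
    by blast
  have "(\<Union>K. A K) \<in> null_sets ?R"
    using A(1) by (intro null_sets_UN) auto
  moreover have "MP_liminf_nonneg game init \<subseteq> (\<Union>K. A K)"
  proof
    fix \<rho> assume "\<rho> \<in> MP_liminf_nonneg game init"
    then obtain N where N: "\<forall>n\<ge>N. \<forall>t. \<not> bad n (map \<rho> [0..<t])"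
      using MP_eventually_not_bad by blast
    have "N \<le> block_start (card Q + N)"
      using block_start_ge[of "card Q + N"] by simp
    with N A(2)[of N] show "\<rho> \<in> (\<Union>K. A K)" by fastforce
  qed
  ultimately have "MP_liminf_nonneg game init \<in> null_sets ?R"
    by (rule null_sets_subset[OF _ MP_liminf_nonneg_measurable])
  then show ?thesis by (simp add: measure_eq_emeasure_eq_ennreal null_sets_def measure_def)
qed

theorem theorem4p23:
  shows "\<exists>(M :: nat mdp) s\<^sub>0.
    is_mdp M \<and> s\<^sub>0 \<in> states M \<and> finitely_branching M \<and> acyclic (transitions M) \<and>
    (\<forall>e\<in>transitions M. rew M e \<in> \<int>) \<and> reward_implicit M s\<^sub>0 \<and>
    (\<exists>\<sigma>. HD_strategy M \<sigma> \<and> measure (run_measure M s\<^sub>0 \<sigma>) (MP_liminf_nonneg M s\<^sub>0) = 1) \<and>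
    (\<forall>\<sigma>. FR_strategy M \<sigma> \<longrightarrow> measure (run_measure M s\<^sub>0 \<sigma>) (MP_liminf_nonneg M s\<^sub>0) = 0)"
proof (intro exI conjI)
  show "is_mdp game" by (rule is_mdp_game)
  show "init \<in> states game" by simp
  show "HD_strategy game mirror" by (rule mirror_HD)
  show "measure (run_measure game init mirror) (MP_liminf_nonneg game init) = 1" by (rule mirror_wins)
qed (use finitely_branching_game acyclic_game rew_game_Ints reward_implicit_game FR_loses in auto)

end
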